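(* Consider the media agency problem with arbitrary transfers (with either the GSP or the VCG mechanism), under the assumption that there exists a bidding strategy $b^c\in[0,1]^{n_c}$ with $\tilde r_i(b^c)-\tilde\pi_i(b^c)\ge t_i$ for all $i\in N_c$. Given $p\in(0,1]$ and an optimal discretized bidding strategy $$\hat b^c\in\arg\max_{b^c\in B^{c,p}}\ \sum_{i\in N_c}\bigl(\tilde r_i(b^c)-\tilde\pi_i(b^c)\bigr),$$ one can find in polynomial time a pair $(\gamma,q)$ that is $p$-IC and IR, i.e. $\mathbb{E}_{b^c\sim\gamma}[\tilde r_i(b^c)]-q_i\ge t_i-p$ for all $i\in N_c$ and $\sum_{i\in N_c}q_i\ge\sum_{i\in N_c}\mathbb{E}_{b^c\sim\gamma}[\tilde\pi_i(b^c)]$, with value $\sum_{i\in N_c}\mathbb{E}_{b^c\sim\gamma}[\tilde r_i(b^c)-\tilde\pi_i(b^c)]\ge OPT-p\,n_c$, where $OPT$ is the optimal value of the media agency problem with arbitrary transfers.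
   Context: Ad auction. There are colluders $N_c=\{1,\dots,n_c\}$ and external agents $N_e=\{1,\dots,n_e\}$, $n=n_c+n_e$ agents in total, and slots $\{1,\dots,m\}$, $m\le n$, with click-through rates $1\ge\lambda_1\ge\dots\ge\lambda_m\ge 0$; set $\lambda_k=0$ for $k>m$. Agent $i$ has valuation $v_i\in[0,1]$; the valuations of the colluders are known. A bidding strategy is a vector $b^c\in B^c:=[0,1]^{n_c}$ of colluders' bids; $b^e\in[0,1]^{n_e}$ is the vector of external bids. Given the full bid profile $b=(b^c,b^e)$, agents are ranked by decreasing bid, and the agent ranked $k$-th gets slot $k$ for $k\le m$ (agents ranked below $m$ get no slot). Ties between a colluder and an external agent are broken in favor of the colluder; ties among colluders are broken by index, with colluders indexed so that $v_1\ge\dots\ge v_{n_c}$. Write $b_{(k)}$ for the $k$-th highest bid ($b_{(n+1)}=0$). An agent $i$ ranked $k$-th has expected revenue $r_i(b)=\lambda_k v_i$, and expected payment - GSP mechanism: $\pi_i(b)=\lambda_k b_{(k+1)}$; - VCG mechanism: $\pi_i(b)=\sum_{j=k+1}^{m+1}b_{(j)}(\lambda_{j-1}-\lambda_j)$ if $k\le m$, and $0$ otherwise. The external profile $b^e$ is drawn from a probability distribution $\gamma^e$ in whose support all bids are representable with $M$ bits (i.e. are integer multiples of $2^{-M}$); $\tilde r_i(b^c)=\mathbb{E}_{b^e\sim\gamma^e}[r_i(b^c,b^e)]$ and $\tilde\pi_i(b^c)=\mathbb{E}_{b^e\sim\gamma^e}[\pi_i(b^c,b^e)]$, and these values are available through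 an oracle taking $b^c$ as input. Media agency problem with arbitrary transfers. Given $t_i\in[0,1]$ for $i\in N_c$, choose a probability distribution $\gamma$ over $B^c$ and transfers $q=(q_i)_{i\in N_c}\in\mathbb{R}^{n_c}$ (possibly negative) to maximize $\sum_{i\in N_c}\mathbb{E}_{b^c\sim\gamma}[\tilde r_i(b^c)-\tilde\pi_i(b^c)]$ subject to IC: $\mathbb{E}_{b^c\sim\gamma}[\tilde r_i(b^c)]-q_i\ge t_i$ for all $i\in N_c$, and IR: $\sum_{i\in N_c}q_i\ge\sum_{i\in N_c}\mathbb{E}_{b^c\sim\gamma}[\tilde\pi_i(b^c)]$. Discretized bids. For an interval $(\alpha,\beta]\subseteq[0,1]$, define recursively $\textsc{Rec}((\alpha,\beta],p,\eta)$: if $\mathbb{P}_{b^e\sim\gamma^e}\{\exists j\in N_e: b^e_j\in(\alpha,\beta]\}\le p$ or $\beta-\alpha\le\eta$, return $\{(\alpha,\beta]\}$; otherwise return $\textsc{Rec}((\alpha,\frac{\alpha+\beta}2],p,\eta)\cup\textsc{Rec}((\frac{\alpha+\beta}2,\beta],p,\eta)$. Let $\eta=2^{-M}$ and $I^{p,\eta}=\textsc{Rec}((0,1],p,\eta)$. The discretized bid values are $\alpha+\tau i$ for $(\alpha,\beta]\in I^{p,\eta}$ and $i\in N_c$, and $B^{c,p}$ is the set of bidding strategies all of whose components are discretized bid values. Here $\tau>0$ is arbitrarily small and serves only to induce tie-breaking; the loss it causes is ignored. That is, a bid $\alpha+\tau i$ has numerical value $\alpha$ in all payments, but is ranked above all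 bids (of external agents or others) less than or equal to $\alpha$, below all external bids greater than $\alpha$, and above a bid $\alpha+\tau i'$ whenever $i>i'$. *)

theory Defs
  imports
    "HOL-Probability.Probability"
    "HOL-Computational_Algebra.Polynomial"
begin

section \<open>The ad auction\<close>

datatype mechanism = GSP | VCG

text \<open>
  Colluders are \<open>{1..nc}\<close>, external agents \<open>{1..ne}\<close>, slots \<open>{1..slots}\<close>. The values of \<open>rate\<close>, \<open>val\<close>
  and \<open>tgt\<close> (the \<open>t\<^sub>i\<close>) outside \<open>{1..slots}\<close>, \<open>{1..nc}\<close>, \<open>{1..nc}\<close> are never used. Valuations of
  external agents do not enter the problem.
\<close>

record auction =
  nc :: nat
  ne :: nat
  slots :: nat
  rate :: "nat \<Rightarrow> real"
  val :: "nat \<Rightarrow> real"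
  tgt :: "nat \<Rightarrow> real"
  bits :: nat
  ext :: "(nat \<Rightarrow> real) pmf"

definition ext_grid :: "auction \<Rightarrow> (nat \<Rightarrow> real) set" where
  "ext_grid A = {1..ne A} \<rightarrow>\<^sub>E {x. 0 \<le> x \<and> x \<le> 1 \<and> (\<exists>z::int. x = of_int z / 2 ^ bits A)}"

definition auction_ok :: "auction \<Rightarrow> bool" where
  "auction_ok A \<longleftrightarrow>
     slots A \<le> nc A + ne A
   \<and> (\<forall>k\<in>{1..slots A}. 0 \<le> rate A k \<and> rate A k \<le> 1)
   \<and> (\<forall>k l. 1 \<le> k \<and> k \<le> l \<and> l \<le> slots A \<longrightarrow> rate A l \<le> rate A k)
   \<and> (\<forall>i\<in>{1..nc A}. 0 \<le> val A i \<and> val A i \<le> 1)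
   \<and> (\<forall>i j. 1 \<le> i \<and> i \<le> j \<and> j \<le> nc A \<longrightarrow> val A j \<le> val A i)
   \<and> (\<forall>i\<in>{1..nc A}. 0 \<le> tgt A i \<and> tgt A i \<le> 1)
   \<and> set_pmf (ext A) \<subseteq> ext_grid A"

text \<open>
  A colluder's bid is a pair \<open>(x, l)\<close> standing for \<open>x + \<tau> l\<close> with an infinitesimal \<open>\<tau> > 0\<close>: its
  numerical value in payments is \<open>x\<close>, and \<open>l\<close> only serves to break ties among colluders. A real bid
  \<open>x\<close> is \<open>(x, 0)\<close>. Against external bids, \<open>x + \<tau> l\<close> and \<open>x\<close> behave alike, because ties between
  a colluder and an external agent are broken in favour of the colluder.
\<close>

type_synonym bid = "real \<times> nat"
type_synonym strategy = "nat \<Rightarrow> bid"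

text \<open>Agents are \<open>Inl i\<close> (colluder \<open>i\<close>) and \<open>Inr j\<close> (external agent \<open>j\<close>).\<close>

definition agents :: "auction \<Rightarrow> (nat + nat) set" where
  "agents A = Inl ` {1..nc A} \<union> Inr ` {1..ne A}"

text \<open>
  Ties between external agents are broken by index; the choice does not affect the revenue or the
  payment of any colluder.
\<close>

fun outranks :: "strategy \<Rightarrow> (nat \<Rightarrow> real) \<Rightarrow> nat + nat \<Rightarrow> nat + nat \<Rightarrow> bool" where
  "outranks b e (Inl i) (Inl i') \<longleftrightarrow>
     fst (b i) > fst (b i') \<or>
     fst (b i) = fst (b i') \<and> (snd (b i) > snd (b i') \<or> snd (b i) = snd (b i') \<and> i < i')"
| "outranks b e (Inl i) (Inr j) \<longleftrightarrow> fst (b i) \<ge> e j"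
| "outranks b e (Inr j) (Inl i) \<longleftrightarrow> e j > fst (b i)"
| "outranks b e (Inr j) (Inr j') \<longleftrightarrow> e j > e j' \<or> e j = e j' \<and> j < j'"

definition rank_of :: "auction \<Rightarrow> strategy \<Rightarrow> (nat \<Rightarrow> real) \<Rightarrow> nat + nat \<Rightarrow> nat" where
  "rank_of A b e a = Suc (card {a' \<in> agents A. outranks b e a' a})"

definition kth_bid :: "auction \<Rightarrow> strategy \<Rightarrow> (nat \<Rightarrow> real) \<Rightarrow> nat \<Rightarrow> real" where
  "kth_bid A b e k =
     (if 1 \<le> k \<and> k \<le> nc A + ne A
      then rev (sort (map (\<lambda>i. fst (b i)) [1..<Suc (nc A)] @ map e [1..<Suc (ne A)])) ! (k - 1)
      else 0)"

definition ctr :: "auction \<Rightarrow> nat \<Rightarrow> real" where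
  "ctr A k = (if k \<le> slots A then rate A k else 0)"

definition revenue :: "auction \<Rightarrow> strategy \<Rightarrow> (nat \<Rightarrow> real) \<Rightarrow> nat \<Rightarrow> real" where
  "revenue A b e i = ctr A (rank_of A b e (Inl i)) * val A i"

definition payment :: "mechanism \<Rightarrow> auction \<Rightarrow> strategy \<Rightarrow> (nat \<Rightarrow> real) \<Rightarrow> nat \<Rightarrow> real" where
  "payment mech A b e i =
     (let k = rank_of A b e (Inl i) in
      case mech of
        GSP \<Rightarrow> ctr A k * kth_bid A b e (k + 1)
      | VCG \<Rightarrow> (if k \<le> slots A
                then \<Sum>j\<in>{k + 1..slots A + 1}. kth_bid A b e j * (ctr A (j - 1) - ctr A j)
                else 0))"

definition exp_revenue :: "auction \<Rightarrow> strategy \<Rightarrow> nat \<Rightarrow> real" where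
  "exp_revenue A b i = measure_pmf.expectation (ext A) (\<lambda>e. revenue A b e i)"

definition exp_payment :: "mechanism \<Rightarrow> auction \<Rightarrow> strategy \<Rightarrow> nat \<Rightarrow> real" where
  "exp_payment mech A b i = measure_pmf.expectation (ext A) (\<lambda>e. payment mech A b e i)"

definition surplus :: "mechanism \<Rightarrow> auction \<Rightarrow> strategy \<Rightarrow> real" where
  "surplus mech A b = (\<Sum>i\<in>{1..nc A}. exp_revenue A b i - exp_payment mech A b i)"

definition real_strategies :: "auction \<Rightarrow> strategy set" where
  "real_strategies A = {1..nc A} \<rightarrow>\<^sub>E ({0..1} \<times> {0})"


section \<open>The media agency problem with arbitrary transfers\<close>

text \<open>
  The following four notions make sense for a measure on any sigma-algebra of strategies; they are
  used both for Borel measures on \<open>real_strategies\<close> and for discrete distributions.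
\<close>

definition agency_value :: "mechanism \<Rightarrow> auction \<Rightarrow> strategy measure \<Rightarrow> real" where
  "agency_value mech A \<gamma> =
     (\<Sum>i\<in>{1..nc A}. \<integral>b. exp_revenue A b i - exp_payment mech A b i \<partial>\<gamma>)"

definition approx_IC :: "real \<Rightarrow> auction \<Rightarrow> strategy measure \<Rightarrow> (nat \<Rightarrow> real) \<Rightarrow> bool" where
  "approx_IC \<epsilon> A \<gamma> q \<longleftrightarrow> (\<forall>i\<in>{1..nc A}. (\<integral>b. exp_revenue A b i \<partial>\<gamma>) - q i \<ge> tgt A i - \<epsilon>)"

abbreviation IC :: "auction \<Rightarrow> strategy measure \<Rightarrow> (nat \<Rightarrow> real) \<Rightarrow> bool" where
  "IC \<equiv> approx_IC 0"

definition IR :: "mechanism \<Rightarrow> auction \<Rightarrow> strategy measure \<Rightarrow> (nat \<Rightarrow> real) \<Rightarrow> bool" where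
  "IR mech A \<gamma> q \<longleftrightarrow>
     (\<Sum>i\<in>{1..nc A}. q i) \<ge> (\<Sum>i\<in>{1..nc A}. \<integral>b. exp_payment mech A b i \<partial>\<gamma>)"

definition real_strategy_dists :: "auction \<Rightarrow> strategy measure set" where
  "real_strategy_dists A =
     {\<gamma>. prob_space \<gamma> \<and>
         sets \<gamma> = sets (PiM {1..nc A} (\<lambda>_. restrict_space (borel :: bid measure) ({0..1} \<times> {0})))}"

definition OPT :: "mechanism \<Rightarrow> auction \<Rightarrow> real" where
  "OPT mech A =
     Sup {agency_value mech A \<gamma> | \<gamma> q. \<gamma> \<in> real_strategy_dists A \<and> IC A \<gamma> q \<and> IR mech A \<gamma> q}"


section \<open>Discretized bids\<close>

text \<open>
  An interval \<open>(\<alpha>, \<beta>]\<close> is represented by the pair \<open>(\<alpha>, \<beta>)\<close>. The disjunct \<open>\<eta> \<le> 0\<close> only makes the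
  recursion total; \<open>\<eta> = 2\<^sup>-\<^sup>M > 0\<close> in all uses.
\<close>

function Rec :: "(nat \<Rightarrow> real) pmf \<Rightarrow> nat \<Rightarrow> real \<Rightarrow> real \<Rightarrow> real \<times> real \<Rightarrow> (real \<times> real) set" where
  "Rec ge n p \<eta> (\<alpha>, \<beta>) =
     (if measure_pmf.prob ge {e. \<exists>j\<in>{1..n}. e j \<in> {\<alpha><..\<beta>}} \<le> p \<or> \<beta> - \<alpha> \<le> \<eta> \<or> \<eta> \<le> 0
      then {(\<alpha>, \<beta>)}
      else Rec ge n p \<eta> (\<alpha>, (\<alpha> + \<beta>) / 2) \<union> Rec ge n p \<eta> ((\<alpha> + \<beta>) / 2, \<beta>))"
  by pat_completeness auto
termination
proof (relation "Wellfounded.measure (\<lambda>(ge, n, p, \<eta>, (\<alpha>, \<beta>)). nat \<lceil>(\<beta> - \<alpha>) / \<eta>\<rceil>)",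
    goal_cases)
  case 1
  show ?case by simp
next
  have half: "nat \<lceil>x / 2\<rceil> < nat \<lceil>x\<rceil>" if "x > 1" for x :: real
  proof -
    have "real_of_int 1 < real_of_int \<lceil>x\<rceil>"
      using that by linarith
    then have "2 \<le> \<lceil>x\<rceil>"
      by linarith
    moreover have "x / 2 \<le> of_int (\<lceil>x\<rceil> - 1)"
      using \<open>2 \<le> \<lceil>x\<rceil>\<close> le_of_int_ceiling[of x] by linarith
    then have "\<lceil>x / 2\<rceil> \<le> \<lceil>x\<rceil> - 1"
      by (rule ceiling_le)
    ultimately show ?thesis
      by linarith
  qed
  {
    case (2 ge n p \<eta> \<alpha> \<beta>)
    then have "(\<beta> - \<alpha>) / \<eta> > 1"
      by (simp add: not_le less_divide_eq)
    moreover have "((\<alpha> + \<beta>) / 2 - \<alpha>) / \<eta> = (\<beta> - \<alpha>) / \<eta> / 2"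
      by (simp add: field_simps)
    ultimately show ?case
      using half[of "(\<beta> - \<alpha>) / \<eta>"] by (simp add: mult.commute)
  next
    case (3 ge n p \<eta> \<alpha> \<beta>)
    then have "(\<beta> - \<alpha>) / \<eta> > 1"
      by (simp add: not_le less_divide_eq)
    moreover have "(\<beta> - (\<alpha> + \<beta>) / 2) / \<eta> = (\<beta> - \<alpha>) / \<eta> / 2"
      by (simp add: field_simps)
    ultimately show ?case
      using half[of "(\<beta> - \<alpha>) / \<eta>"] by (simp add: mult.commute)
  }
qed

declare Rec.simps [simp del]

definition intervals :: "auction \<Rightarrow> real \<Rightarrow> (real \<times> real) set" where
  "intervals A p = Rec (ext A) (ne A) p (1 / 2 ^ bits A) (0, 1)"

definition disc_bids :: "auction \<Rightarrow> real \<Rightarrow> bid set" where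
  "disc_bids A p = {(\<alpha>, i) | \<alpha> \<beta> i. (\<alpha>, \<beta>) \<in> intervals A p \<and> i \<in> {1..nc A}}"

definition disc_strategies :: "auction \<Rightarrow> real \<Rightarrow> strategy set" where
  "disc_strategies A p = {1..nc A} \<rightarrow>\<^sub>E disc_bids A p"

definition strategies :: "auction \<Rightarrow> real \<Rightarrow> strategy set" where
  "strategies A p = real_strategies A \<union> disc_strategies A p"


section \<open>A machine model for polynomial-time oracle algorithms\<close>

text \<open>
  Programs run on a real random-access machine with unit-cost steps, equipped with an oracle for the
  expected revenues and payments. A program is a finite piece of syntax that mentions only integer
  constants and is independent of the instance. The memory consists of named scalars and named
  arrays.

  The arithmetic is deliberately limited to addition and subtraction. After \<open>T\<close> steps each stored
  number is a combination of constants, inputs and oracle answers with integer coefficients of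
  absolute value at most \<open>2\<^sup>T\<close>, so on rational data all bit lengths stay polynomial in \<open>T\<close> and the
  lengths of the inputs and of the oracle answers. Hence a polynomial bound on the number of steps
  also is a polynomial bound in the bit model; unit-cost multiplication would break this.
\<close>

type_synonym vname = string

record state =
  scalar :: "vname \<Rightarrow> real"
  arr :: "vname \<Rightarrow> nat \<Rightarrow> real"

definition set_scalar :: "vname \<Rightarrow> real \<Rightarrow> state \<Rightarrow> state" where
  "set_scalar x r s = s\<lparr>scalar := (scalar s)(x := r)\<rparr>"

definition set_arr :: "vname \<Rightarrow> nat \<Rightarrow> real \<Rightarrow> state \<Rightarrow> state" where
  "set_arr a k r s = s\<lparr>arr := (arr s)(a := (arr s a)(k := r))\<rparr>"

datatype com =
    Skip
  | Const vname int
  | Add vname vname vname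
  | Sub vname vname vname
  | Load vname vname vname
  | Store vname vname vname
  | QueryRevenue vname vname vname vname
  | QueryPayment vname vname vname vname
  | Seq com com
  | IfLe vname vname com com
  | WhileLe vname vname com

text \<open>
  \<open>strategy_at n s a l off b\<close>: the strategy \<open>b\<close> of \<open>n\<close> colluders is stored in cells
  \<open>off + 1, \<dots>, off + n\<close> of the arrays \<open>a\<close> (numerical values) and \<open>l\<close> (multiples of \<open>\<tau>\<close>).
\<close>

definition strategy_at ::
    "nat \<Rightarrow> state \<Rightarrow> vname \<Rightarrow> vname \<Rightarrow> nat \<Rightarrow> strategy \<Rightarrow> bool" where
  "strategy_at n s a l off b \<longleftrightarrow>
     b \<in> extensional {1..n} \<and>
     (\<forall>i\<in>{1..n}. arr s a (off + i) = fst (b i) \<and> arr s l (off + i) = real (snd (b i)))"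

text \<open>
  \<open>exec n S R P c s T s'\<close>: started in \<open>s\<close>, program \<open>c\<close> halts in \<open>s'\<close> after \<open>T\<close> steps, where the
  oracle answers \<open>R b i\<close> and \<open>P b i\<close> to queries for \<open>b \<in> S\<close> and \<open>i \<in> {1..n}\<close>. The semantics is
  deterministic; array accesses at indices that are not natural numbers and queries outside the
  domain of the oracle have no successor state.
\<close>

inductive exec ::
    "nat \<Rightarrow> strategy set \<Rightarrow> (strategy \<Rightarrow> nat \<Rightarrow> real) \<Rightarrow> (strategy \<Rightarrow> nat \<Rightarrow> real) \<Rightarrow>
     com \<Rightarrow> state \<Rightarrow> nat \<Rightarrow> state \<Rightarrow> bool"
  for n :: nat and S :: "strategy set" and R P :: "strategy \<Rightarrow> nat \<Rightarrow> real"
where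
  Skip: "exec n S R P Skip s 1 s"
| Const: "exec n S R P (Const x z) s 1 (set_scalar x (of_int z) s)"
| Add: "exec n S R P (Add x y z) s 1 (set_scalar x (scalar s y + scalar s z) s)"
| Sub: "exec n S R P (Sub x y z) s 1 (set_scalar x (scalar s y - scalar s z) s)"
| Load: "scalar s y = real k \<Longrightarrow> exec n S R P (Load x a y) s 1 (set_scalar x (arr s a k) s)"
| Store: "scalar s y = real k \<Longrightarrow> exec n S R P (Store a y x) s 1 (set_arr a k (scalar s x) s)"
| QueryRevenue:
    "\<lbrakk>strategy_at n s a l 0 b; b \<in> S; scalar s y = real i; i \<in> {1..n}\<rbrakk> \<Longrightarrow>
     exec n S R P (QueryRevenue x a l y) s 1 (set_scalar x (R b i) s)"
| QueryPayment:
    "\<lbrakk>strategy_at n s a l 0 b; b \<in> S; scalar s y = real i; i \<in> {1..n}\<rbrakk> \<Longrightarrow>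
     exec n S R P (QueryPayment x a l y) s 1 (set_scalar x (P b i) s)"
| Seq:
    "\<lbrakk>exec n S R P c1 s T1 s'; exec n S R P c2 s' T2 s''\<rbrakk> \<Longrightarrow>
     exec n S R P (Seq c1 c2) s (T1 + T2) s''"
| IfTrue:
    "\<lbrakk>scalar s x \<le> scalar s y; exec n S R P c1 s T s'\<rbrakk> \<Longrightarrow>
     exec n S R P (IfLe x y c1 c2) s (Suc T) s'"
| IfFalse:
    "\<lbrakk>\<not> scalar s x \<le> scalar s y; exec n S R P c2 s T s'\<rbrakk> \<Longrightarrow>
     exec n S R P (IfLe x y c1 c2) s (Suc T) s'"
| WhileFalse:
    "\<not> scalar s x \<le> scalar s y \<Longrightarrow> exec n S R P (WhileLe x y c) s 1 s"
| WhileTrue: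
    "\<lbrakk>scalar s x \<le> scalar s y; exec n S R P c s T1 s'; exec n S R P (WhileLe x y c) s' T2 s''\<rbrakk> \<Longrightarrow>
     exec n S R P (WhileLe x y c) s (Suc (T1 + T2)) s''"

lemma strategy_at_unique:
  assumes "strategy_at n s a l off b" and "strategy_at n s a l off b'"
  shows "b = b'"
proof
  fix i
  show "b i = b' i"
  proof (cases "i \<in> {1..n}")
    case True
    with assms have "fst (b i) = fst (b' i)" "real (snd (b i)) = real (snd (b' i))"
      unfolding strategy_at_def by metis+
    then show ?thesis by (simp add: prod_eq_iff)
  next
    case False
    with assms show ?thesis
      unfolding strategy_at_def by (metis extensional_arb)
  qed
qed

lemma exec_deterministic:
  "exec n S R P c s T s' \<Longrightarrow> exec n S R P c s T' s'' \<Longrightarrow> T' = T \<and> s'' = s'"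
proof (induction arbitrary: T' s'' rule: exec.induct)
  case (QueryRevenue s a l b y i x)
  from QueryRevenue.prems show ?case
    by cases (use QueryRevenue.hyps in \<open>simp, metis strategy_at_unique\<close>)
next
  case (QueryPayment s a l b y i x)
  from QueryPayment.prems show ?case
    by cases (use QueryPayment.hyps in \<open>simp, metis strategy_at_unique\<close>)
next
  case (Seq c1 s T1 s1 c2 T2 s2)
  from Seq.prems show ?case by cases (use Seq.IH in blast)
next
  case (IfTrue s x y c1 T s1 c2)
  from IfTrue.prems show ?case by cases (use IfTrue in blast)+
next
  case (IfFalse s x y c2 T s1 c1)
  from IfFalse.prems show ?case by cases (use IfFalse in blast)+
next
  case (WhileTrue s x y c T1 s1 T2 s2)
  from WhileTrue.prems show ?case by cases (use WhileTrue in blast)+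
qed (erule exec.cases; simp)+

text \<open>
  The input consists of the known data and the strategy \<open>b\<close>; the external distribution is accessible
  through the oracle only. All other cells are zero, so that nothing else can be read off.
\<close>

definition init_scalar :: "auction \<Rightarrow> real \<Rightarrow> vname \<Rightarrow> real" where
  "init_scalar A p x =
     (if x = ''nc'' then real (nc A)
      else if x = ''ne'' then real (ne A)
      else if x = ''m'' then real (slots A)
      else if x = ''M'' then real (bits A)
      else if x = ''p'' then p
      else 0)"

definition init_arr :: "auction \<Rightarrow> strategy \<Rightarrow> vname \<Rightarrow> nat \<Rightarrow> real" where
  "init_arr A b a k =
     (if a = ''lambda'' \<and> k \<in> {1..slots A} then rate A k
      else if a = ''v'' \<and> k \<in> {1..nc A} then val A k
      else if a = ''t'' \<and> k \<in> {1..nc A} then tgt A k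
      else if a = ''bid'' \<and> k \<in> {1..nc A} then fst (b k)
      else if a = ''level'' \<and> k \<in> {1..nc A} then real (snd (b k))
      else 0)"

definition init_state :: "auction \<Rightarrow> real \<Rightarrow> strategy \<Rightarrow> state" where
  "init_state A p b = \<lparr>scalar = init_scalar A p, arr = init_arr A b\<rparr>"

text \<open>
  The output \<open>(\<gamma>, q)\<close> consists of \<open>K\<close> strategies, stored consecutively, with their probabilities,
  and of the transfers.
\<close>

definition outputs :: "nat \<Rightarrow> state \<Rightarrow> strategy pmf \<Rightarrow> (nat \<Rightarrow> real) \<Rightarrow> bool" where
  "outputs n s \<gamma> q \<longleftrightarrow>
     (\<exists>xs. scalar s ''K'' = real (length xs)
         \<and> (\<forall>k<length xs. strategy_at n s ''gamma_bid'' ''gamma_level'' (k * n) (fst (xs ! k))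
                         \<and> arr s ''gamma_prob'' (k + 1) = snd (xs ! k))
         \<and> pmf_of_list_wf xs \<and> \<gamma> = pmf_of_list xs)
   \<and> (\<forall>i\<in>{1..n}. q i = arr s ''q'' i)"

end

theory Submission
  imports Defs
begin

text \<open>
  Take for \<open>\<gamma>\<close> the point mass at the optimal discretized strategy and let agent \<open>i\<close> pay
  \<open>q\<^sub>i = r\<^sub>i - t\<^sub>i + p\<close>. This is \<open>p\<close>-IC by construction, and both IR and the value bound follow once every
  real strategy \<open>b\<close> is matched by a discretized strategy \<open>d\<close> whose surplus is smaller by at most
  \<open>p n\<^sub>c\<close>.

  To get \<open>d\<close>, round every bid down to the nearest left endpoint and choose the levels so that the
  order among the colluders is kept. All bids only decrease, so an agent falling from rank \<open>k\<close> to
  \<open>k'\<close> loses at most \<open>(\<lambda>\<^sub>k - \<lambda>\<^sub>k\<^sub>') v\<^sub>i \<le> 1\<close>, and it falls only if some external bid lies between its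
  rounded and its original bid. That has probability at most \<open>p\<close>, except for intervals of the
  finest width, where such an external bid must equal the right endpoint. A right endpoint below 1
  is itself a discretized bid, so the remaining case is that of bids equal to 1. There the lost clicks
  were paid for at a price of \<open>1 \<ge> v\<^sub>i\<close> each, and nothing is lost.
\<close>

section \<open>Order statistics of the bids\<close>

text \<open>In a decreasing list the entries that are at least \<open>c\<close> form a prefix, and
  the filter counts its length.\<close>

lemma desc_nth_ge_iff:
  fixes ys :: "'a::linorder list"
  assumes "sorted_wrt (\<ge>) ys" and "k < length ys"
  shows "c \<le> ys ! k \<longleftrightarrow> k < length (filter (\<lambda>x. c \<le> x) ys)"
  using assms
proof (induction ys arbitrary: k)
  case (Cons y ys)
  show ?case
  proof (cases "c \<le> y")
    case True
    with Cons show ?thesis by (cases k) auto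
  next
    case False
    have "\<not> c \<le> x" if "x \<in> set (y # ys)" for x
    proof -
      have "x \<le> y" using that Cons.prems(1) by auto
      with False show ?thesis using order_trans by blast
    qed
    moreover from this have "filter (\<lambda>x. c \<le> x) (y # ys) = []"
      by (simp only: filter_empty_conv) blast
    ultimately show ?thesis
      using nth_mem[OF Cons.prems(2)] by (metis less_nat_zero_code list.size(3))
  qed
qed simp

lemma rev_sort_nth_ge_iff:
  fixes xs :: "'a::linorder list"
  assumes "k < length xs"
  shows "c \<le> rev (sort xs) ! k \<longleftrightarrow> k < length (filter (\<lambda>x. c \<le> x) xs)"
proof -
  have "sorted_wrt (\<ge>) (rev (sort xs))"
    by (simp add: sorted_wrt_rev)
  moreover have "length (filter (\<lambda>x. c \<le> x) (rev (sort xs))) = length (filter (\<lambda>x. c \<le> x) xs)"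
    by (simp flip: size_mset add: mset_filter)
  ultimately show ?thesis
    using desc_nth_ge_iff[of "rev (sort xs)" k c] assms by simp
qed

definition bid_value :: "strategy \<Rightarrow> (nat \<Rightarrow> real) \<Rightarrow> nat + nat \<Rightarrow> real" where
  "bid_value b e a = (case a of Inl i \<Rightarrow> fst (b i) | Inr j \<Rightarrow> e j)"

lemma finite_agents [simp]: "finite (agents A)"
  by (simp add: agents_def)

lemma card_agents: "card (agents A) = nc A + ne A"
  unfolding agents_def by (subst card_Un_disjoint) (auto simp: card_image)

lemma kth_bid_outside:
  assumes "\<not> (1 \<le> k \<and> k \<le> nc A + ne A)"
  shows "kth_bid A b e k = 0"
  using assms unfolding kth_bid_def by (rule if_not_P)

text \<open>Since sorting does not change counts, order statistics can be handled by counting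
  agents. Bounds, monotonicity and measurability of \<open>kth_bid\<close> are all derived from this
  equivalence instead of the sorted list.\<close>

lemma kth_bid_ge_iff:
  assumes "1 \<le> k" and "k \<le> nc A + ne A"
  shows "c \<le> kth_bid A b e k \<longleftrightarrow> k \<le> card {a \<in> agents A. c \<le> bid_value b e a}"
proof -
  let ?xs = "map (\<lambda>i. fst (b i)) [1..<Suc (nc A)] @ map e [1..<Suc (ne A)]"
  let ?I = "{i \<in> {1..nc A}. c \<le> fst (b i)}" and ?J = "{j \<in> {1..ne A}. c \<le> e j}"
  have "length (filter (\<lambda>x. c \<le> x) ?xs) = card ?I + card ?J"
    by (simp add: filter_map distinct_length_filter Collect_conj_eq Int_commute
        atLeastLessThanSuc_atLeastAtMost atLeastAtMost_def del: upt_Suc)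
       (intro arg_cong2[where f = "(+)"] arg_cong[where f = card]; auto)
  also have "\<dots> = card (Inl ` ?I :: (nat + nat) set) + card (Inr ` ?J :: (nat + nat) set)"
    by (simp add: card_image)
  also have "\<dots> = card (Inl ` ?I \<union> Inr ` ?J :: (nat + nat) set)"
    by (subst card_Un_disjoint) auto
  also have "(Inl ` ?I \<union> Inr ` ?J :: (nat + nat) set) = {a \<in> agents A. c \<le> bid_value b e a}"
    by (auto simp: agents_def bid_value_def)
  finally have "length (filter (\<lambda>x. c \<le> x) ?xs) = card {a \<in> agents A. c \<le> bid_value b e a}" .
  then show ?thesis
    using assms rev_sort_nth_ge_iff[of "k - 1" ?xs c]
    by (auto simp: kth_bid_def simp del: upt_Suc)
qed

lemma kth_bid_bounds:
  assumes "\<And>a. a \<in> agents A \<Longrightarrow> 0 \<le> bid_value b e a \<and> bid_value b e a \<le> 1"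
  shows "0 \<le> kth_bid A b e k" and "kth_bid A b e k \<le> 1"
proof -
  show "0 \<le> kth_bid A b e k"
  proof (cases "1 \<le> k \<and> k \<le> nc A + ne A")
    case True
    moreover have "{a \<in> agents A. 0 \<le> bid_value b e a} = agents A"
      using assms by auto
    ultimately show ?thesis
      by (simp add: kth_bid_ge_iff card_agents)
  qed (simp add: kth_bid_outside)
  show "kth_bid A b e k \<le> 1"
  proof (cases "1 \<le> k \<and> k \<le> nc A + ne A")
    case True
    \<comment> \<open>Taking the order statistic itself as the threshold shows that at least
      \<open>k\<close> agents, hence some agent, bid that much.\<close>
    then have "k \<le> card {a \<in> agents A. kth_bid A b e k \<le> bid_value b e a}"
      using kth_bid_ge_iff by blast
    with True have "{a \<in> agents A. kth_bid A b e k \<le> bid_value b e a} \<noteq> {}"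
      by (metis card.empty not_one_le_zero order_trans)
    then show ?thesis using assms by (auto intro: order_trans)
  qed (simp add: kth_bid_outside)
qed

text \<open>If \<open>l\<close> agents reach a threshold, so do \<open>k\<close>. The bounds on the
  bids serve the case where \<open>l\<close> exceeds the number of agents: there
  \<open>kth_bid\<close> is 0 by convention, and the other side must be nonnegative.\<close>

lemma kth_bid_antimono:
  assumes "\<And>a. a \<in> agents A \<Longrightarrow> 0 \<le> bid_value b e a \<and> bid_value b e a \<le> 1"
    and "1 \<le> k" and "k \<le> l"
  shows "kth_bid A b e l \<le> kth_bid A b e k"
proof (cases "l \<le> nc A + ne A")
  case True
  then have "l \<le> card {a \<in> agents A. kth_bid A b e l \<le> bid_value b e a}"
    using kth_bid_ge_iff[of l A "kth_bid A b e l" b e] assms(2,3) by simp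
  then show ?thesis
    using kth_bid_ge_iff[of k A "kth_bid A b e l" b e] assms(2,3) True by simp
next
  case False
  then have "kth_bid A b e l = 0" by (intro kth_bid_outside) simp
  then show ?thesis using kth_bid_bounds(1)[OF assms(1)] by simp
qed

lemma kth_bid_mono:
  assumes "\<And>a. a \<in> agents A \<Longrightarrow> bid_value b' e a \<le> bid_value b e a"
  shows "kth_bid A b' e k \<le> kth_bid A b e k"
proof (cases "1 \<le> k \<and> k \<le> nc A + ne A")
  case True
  let ?c = "kth_bid A b' e k"
  have "k \<le> card {a \<in> agents A. ?c \<le> bid_value b' e a}"
    using kth_bid_ge_iff True by blast
  also have "\<dots> \<le> card {a \<in> agents A. ?c \<le> bid_value b e a}"
    using assms by (intro card_mono) (auto intro: order_trans)
  finally show ?thesis using kth_bid_ge_iff True by blast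
qed (simp add: kth_bid_outside)

section \<open>Payments as a function of rank and sorted bids\<close>

lemma ctr_antimono:
  assumes "auction_ok A" and "1 \<le> k" and "k \<le> l"
  shows "ctr A l \<le> ctr A k"
  using assms unfolding auction_ok_def ctr_def by auto

lemma ctr_bounds:
  assumes "auction_ok A" and "1 \<le> k"
  shows "0 \<le> ctr A k" and "ctr A k \<le> 1"
  using assms unfolding auction_ok_def ctr_def by auto

text \<open>Separating the rank from the sorted bids lets the two vary independently. For
  \<open>k > slots A\<close> the VCG sum is empty, in agreement with the 0 in
  \<open>payment\<close>.\<close>

definition charge :: "mechanism \<Rightarrow> auction \<Rightarrow> (nat \<Rightarrow> real) \<Rightarrow> nat \<Rightarrow> real" where
  "charge mech A B k =
     (case mech of
        GSP \<Rightarrow> ctr A k * B (k + 1)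
      | VCG \<Rightarrow> \<Sum>j\<in>{k + 1..slots A + 1}. B j * (ctr A (j - 1) - ctr A j))"

lemma payment_eq_charge:
  "payment mech A b e i = charge mech A (kth_bid A b e) (rank_of A b e (Inl i))"
  by (auto simp: payment_def charge_def Let_def split: mechanism.split)

text \<open>
  Moving down from rank \<open>k\<close> to rank \<open>k'\<close> gives up click-through rate that was paid for at a price
  of at least \<open>c\<close> per click.
\<close>

lemma charge_diff_ge:
  assumes ok: "auction_ok A" and "1 \<le> k" and "k \<le> k'" and le: "\<And>j. B' j \<le> B j"
    and anti: "\<And>j l. 1 \<le> j \<Longrightarrow> j \<le> l \<Longrightarrow> B l \<le> B j"
    and c: "\<And>j. j \<in> {k + 1..k'} \<Longrightarrow> c \<le> B j"
  shows "charge mech A B' k' + c * (ctr A k - ctr A k') \<le> charge mech A B k"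
proof (cases mech)
  case GSP
  have ctr: "ctr A k' \<le> ctr A k" "0 \<le> ctr A k'"
    using ok assms(2,3) by (auto intro: ctr_antimono ctr_bounds)
  have "B' (k' + 1) \<le> B (k + 1)"
    using le[of "k' + 1"] anti[of "k + 1" "k' + 1"] \<open>k \<le> k'\<close> by simp
  then have 1: "ctr A k' * B' (k' + 1) \<le> ctr A k' * B (k + 1)"
    using ctr by (intro mult_left_mono)
  \<comment> \<open>The lost clicks were all priced at the single bid \<open>B (k + 1)\<close>. For
    \<open>k = k'\<close> nothing relates this bid to \<open>c\<close>, but then no clicks are
    lost.\<close>
  have "c * (ctr A k - ctr A k') \<le> B (k + 1) * (ctr A k - ctr A k')"
  proof (cases "k = k'")
    case False
    with \<open>k \<le> k'\<close> have "c \<le> B (k + 1)" by (intro c) simp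
    then show ?thesis using ctr by (intro mult_right_mono) auto
  qed simp
  with 1 GSP show ?thesis by (simp add: charge_def algebra_simps)
next
  case VCG
  let ?f = "\<lambda>B j. B j * (ctr A (j - 1) - ctr A j)"
  let ?S = "\<lambda>B k. \<Sum>j\<in>{k + 1..slots A + 1}. ?f B j"
  \<comment> \<open>First the rank drops one position at a time with \<open>B\<close> fixed: each
    drop removes one summand, whose bid is at least \<open>c\<close>, and beyond the last slot both
    sides vanish. Only afterwards is \<open>B\<close> lowered to \<open>B'\<close>, at rank
    \<open>k'\<close>.\<close>
  have "?S B k' + c * (ctr A k - ctr A k') \<le> ?S B k"
    using \<open>k \<le> k'\<close> c
  proof (induction k' rule: dec_induct)
    case (step l)
    have "?S B (Suc l) + c * (ctr A l - ctr A (Suc l)) \<le> ?S B l"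
    proof (cases "l \<le> slots A")
      case True
      then have "{l + 1..slots A + 1} = insert (Suc l) {Suc l + 1..slots A + 1}" by auto
      then have "?S B l = B (Suc l) * (ctr A l - ctr A (Suc l)) + ?S B (Suc l)" by simp
      moreover have "ctr A (Suc l) \<le> ctr A l"
        using ok \<open>1 \<le> k\<close> step.hyps by (intro ctr_antimono) auto
      moreover have "c \<le> B (Suc l)" using step by auto
      ultimately show ?thesis by (simp add: mult_right_mono)
    qed (simp add: ctr_def)
    moreover have "?S B l + c * (ctr A k - ctr A l) \<le> ?S B k"
      using step by auto
    ultimately show ?case by (simp add: algebra_simps)
  qed simp
  moreover have "?S B' k' \<le> ?S B k'"
    using ok le \<open>1 \<le> k\<close> \<open>k \<le> k'\<close> by (intro sum_mono mult_right_mono) (auto intro!: ctr_antimono)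
  ultimately show ?thesis using VCG by (simp add: charge_def)
qed

section \<open>Rounding bids down\<close>

definition utility :: "mechanism \<Rightarrow> auction \<Rightarrow> strategy \<Rightarrow> (nat \<Rightarrow> real) \<Rightarrow> nat \<Rightarrow> real" where
  "utility mech A b e i = revenue A b e i - payment mech A b e i"

text \<open>Because the order among colluders is preserved, a rank can change only through external
  bids between the rounded and the original bid.\<close>

definition coarsens :: "auction \<Rightarrow> strategy \<Rightarrow> strategy \<Rightarrow> bool" where
  "coarsens A d b \<longleftrightarrow>
     (\<forall>i\<in>{1..nc A}. 0 \<le> fst (d i) \<and> fst (d i) \<le> fst (b i) \<and> fst (b i) \<le> 1) \<and>
     (\<forall>i\<in>{1..nc A}. \<forall>i'\<in>{1..nc A}. \<forall>e.
        outranks b e (Inl i') (Inl i) \<longleftrightarrow> outranks d e (Inl i') (Inl i))"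

lemma coarsens_bids:
  assumes "coarsens A d b" and "i \<in> {1..nc A}"
  shows "0 \<le> fst (d i)" and "fst (d i) \<le> fst (b i)" and "fst (b i) \<le> 1"
  using assms unfolding coarsens_def by blast+

lemma coarsens_outranks:
  assumes "coarsens A d b" and "i \<in> {1..nc A}" and "i' \<in> {1..nc A}"
  shows "outranks d e (Inl i') (Inl i) \<longleftrightarrow> outranks b e (Inl i') (Inl i)"
  using assms unfolding coarsens_def by blast

lemma rank_of_le:
  assumes "i \<in> {1..nc A}"
  shows "rank_of A b e (Inl i) \<le> nc A + ne A"
proof -
  have "{a' \<in> agents A. outranks b e a' (Inl i)} \<subseteq> agents A - {Inl i}"
    by auto
  then have "card {a' \<in> agents A. outranks b e a' (Inl i)} \<le> card (agents A - {Inl i})"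
    by (intro card_mono) auto
  also have "\<dots> < card (agents A)"
    using assms by (intro psubset_card_mono) (auto simp: agents_def)
  finally show ?thesis by (simp add: rank_of_def card_agents)
qed

lemma rank_of_coarsens_le:
  assumes "coarsens A d b" and "i \<in> {1..nc A}"
  shows "rank_of A b e (Inl i) \<le> rank_of A d e (Inl i)"
  unfolding rank_of_def
proof (intro Suc_le_mono[THEN iffD2] card_mono subsetI)
  fix a assume "a \<in> {a' \<in> agents A. outranks b e a' (Inl i)}"
  then have a: "a \<in> agents A" "outranks b e a (Inl i)" by auto
  have "outranks d e a (Inl i)"
  proof (cases a)
    case (Inl i')
    then show ?thesis using a coarsens_outranks[OF assms, of i' e] by (auto simp: agents_def)
  next
    case (Inr j)
    then show ?thesis using a(2) coarsens_bids(2)[OF assms] by simp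
  qed
  with a show "a \<in> {a' \<in> agents A. outranks d e a' (Inl i)}" by simp
qed simp

text \<open>Without external bids in the gap, the set of agents ahead of \<open>i\<close> is
  unchanged. Otherwise such a bid equals 1, which forces \<open>i\<close> to bid 1 in
  \<open>b\<close>. Then everyone ahead of \<open>i\<close> after rounding already bids at least 1
  under \<open>b\<close>: colluders because they were ahead of \<open>i\<close> before, external
  agents because they lie in the gap.\<close>

lemma rank_of_coarsens_eq_or:
  assumes co: "coarsens A d b" and i: "i \<in> {1..nc A}"
    and e: "\<And>j. j \<in> {1..ne A} \<Longrightarrow> e j \<le> 1"
    and top: "\<And>j. j \<in> {1..ne A} \<Longrightarrow> e j \<in> {fst (d i)<..fst (b i)} \<Longrightarrow> e j = 1"
  shows "rank_of A d e (Inl i) = rank_of A b e (Inl i) \<or> 1 \<le> kth_bid A b e (rank_of A d e (Inl i))"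
proof (cases "\<exists>j\<in>{1..ne A}. e j \<in> {fst (d i)<..fst (b i)}")
  case True
  then have bi: "fst (b i) = 1"
    using coarsens_bids(3)[OF co i] top by fastforce
  let ?O = "{a' \<in> agents A. outranks d e a' (Inl i)}"
  have "insert (Inl i) ?O \<subseteq> {a \<in> agents A. 1 \<le> bid_value b e a}"
  proof
    fix a assume a: "a \<in> insert (Inl i) ?O"
    show "a \<in> {a \<in> agents A. 1 \<le> bid_value b e a}"
    proof (cases a)
      case (Inl i')
      with a i have i': "i' \<in> {1..nc A}" by (auto simp: agents_def)
      have "i' = i \<or> outranks b e (Inl i') (Inl i)"
        using a Inl coarsens_outranks[OF co i i', of e] by auto
      then have "1 \<le> fst (b i')" using bi by auto
      then show ?thesis using Inl i' by (simp add: agents_def bid_value_def)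
    next
      case (Inr j)
      then show ?thesis
        using a bi e[of j] top[of j] by (auto simp: agents_def bid_value_def)
    qed
  qed
  then have "card (insert (Inl i) ?O) \<le> card {a \<in> agents A. 1 \<le> bid_value b e a}"
    by (intro card_mono) auto
  \<comment> \<open>No agent outranks itself, so inserting \<open>Inl i\<close> accounts for the
    \<open>Suc\<close> in \<open>rank_of\<close>.\<close>
  moreover have "card (insert (Inl i) ?O) = rank_of A d e (Inl i)"
    by (simp add: rank_of_def)
  ultimately have "1 \<le> kth_bid A b e (rank_of A d e (Inl i))"
    using rank_of_le[OF i, of d e] by (subst kth_bid_ge_iff) (auto simp: rank_of_def)
  then show ?thesis ..
next
  case False
  have "outranks d e a (Inl i) \<longleftrightarrow> outranks b e a (Inl i)" if "a \<in> agents A" for a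
  proof (cases a)
    case (Inl i')
    then show ?thesis using that coarsens_outranks[OF co i, of i' e] by (auto simp: agents_def)
  next
    case (Inr j)
    with that have "j \<in> {1..ne A}" by (auto simp: agents_def)
    then show ?thesis using Inr False coarsens_bids(2)[OF co i] by auto
  qed
  then have "{a' \<in> agents A. outranks d e a' (Inl i)} = {a' \<in> agents A. outranks b e a' (Inl i)}"
    by blast
  then show ?thesis by (simp add: rank_of_def)
qed

text \<open>The first bound only uses that the lost clicks are worth at most 1. In the second, a
  change of rank means that each lost click had cost at least 1, which is no less than its
  value.\<close>

lemma utility_coarsens:
  assumes ok: "auction_ok A" and co: "coarsens A d b" and i: "i \<in> {1..nc A}"
    and e: "\<And>j. j \<in> {1..ne A} \<Longrightarrow> 0 \<le> e j \<and> e j \<le> 1"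
  shows "utility mech A b e i - 1 \<le> utility mech A d e i"
    and "(\<And>j. j \<in> {1..ne A} \<Longrightarrow> e j \<in> {fst (d i)<..fst (b i)} \<Longrightarrow> e j = 1) \<Longrightarrow>
         utility mech A b e i \<le> utility mech A d e i"
proof -
  let ?B = "kth_bid A b e" and ?B' = "kth_bid A d e"
  let ?k = "rank_of A b e (Inl i)" and ?k' = "rank_of A d e (Inl i)"
  have bnd: "0 \<le> bid_value b e a \<and> bid_value b e a \<le> 1" if "a \<in> agents A" for a
    using that e coarsens_bids(3)[OF co] order_trans[OF coarsens_bids(1,2)[OF co]]
    by (auto simp: agents_def bid_value_def)
  have k: "1 \<le> ?k" "?k \<le> ?k'"
    using rank_of_coarsens_le[OF co i] by (auto simp: rank_of_def)
  have le: "?B' j \<le> ?B j" for j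
    using coarsens_bids(2)[OF co] by (intro kth_bid_mono) (auto simp: agents_def bid_value_def)
  have v: "0 \<le> val A i" "val A i \<le> 1"
    using ok i by (auto simp: auction_ok_def)
  \<comment> \<open>Lost revenue is \<open>val A i\<close> per click, saved payment at least
    \<open>c\<close> per click. This is used with \<open>c = 0\<close> and
    \<open>c = 1\<close>.\<close>
  have diff: "utility mech A b e i - utility mech A d e i
      \<le> (ctr A ?k - ctr A ?k') * (val A i - c)"
    if "\<And>j. j \<in> {?k + 1..?k'} \<Longrightarrow> c \<le> ?B j" for c
    using charge_diff_ge[OF ok k le kth_bid_antimono[OF bnd] that]
    by (simp add: utility_def revenue_def payment_eq_charge algebra_simps)
  have ctr: "ctr A ?k' \<le> ctr A ?k" "0 \<le> ctr A ?k'" "ctr A ?k \<le> 1"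
    using ok k by (auto intro: ctr_antimono ctr_bounds)
  have "(ctr A ?k - ctr A ?k') * val A i \<le> 1"
    using ctr v by (intro mult_le_one) auto
  then show "utility mech A b e i - 1 \<le> utility mech A d e i"
    using diff[of 0] kth_bid_bounds(1)[OF bnd] by simp
  assume "\<And>j. j \<in> {1..ne A} \<Longrightarrow> e j \<in> {fst (d i)<..fst (b i)} \<Longrightarrow> e j = 1"
  then consider "?k' = ?k" | "1 \<le> ?B ?k'"
    using rank_of_coarsens_eq_or[OF co i, of e] e by blast
  then show "utility mech A b e i \<le> utility mech A d e i"
  proof cases
    case 1
    then show ?thesis using diff[of 0] by simp
  next
    case 2
    have "1 \<le> ?B j" if "j \<in> {?k + 1..?k'}" for j
      using kth_bid_antimono[of A b e j ?k', OF bnd] that 2 by simp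
    then have "utility mech A b e i - utility mech A d e i \<le> (ctr A ?k - ctr A ?k') * (val A i - 1)"
      by (intro diff) auto
    also have "\<dots> \<le> 0"
      using ctr v by (intro mult_nonneg_nonpos) auto
    finally show ?thesis by simp
  qed
qed

section \<open>Dyadic intervals and their left endpoints\<close>

text \<open>The halves of a dyadic cell with numerator \<open>z\<close> are the cells of the next
  level with numerators \<open>2 * z\<close> and \<open>2 * z + 1\<close>, in the form that the
  induction on the recursion needs.\<close>

lemma dyadic_half:
  fixes z :: int
  assumes "\<alpha> = of_int z / 2 ^ s" and "\<beta> = (of_int z + 1) / (2 ^ s :: real)"
  shows "\<alpha> = of_int (2 * z) / 2 ^ Suc s" and "(\<alpha> + \<beta>) / 2 = (of_int (2 * z) + 1) / 2 ^ Suc s"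
    and "(\<alpha> + \<beta>) / 2 = of_int (2 * z + 1) / 2 ^ Suc s" and "\<beta> = (of_int (2 * z + 1) + 1) / 2 ^ Suc s"
  unfolding assms by (simp_all add: add_divide_distrib)

text \<open>
  Rounding a colluder's bid \<open>x\<close> down to \<open>a\<close> changes its position relative to the external bids with
  probability at most \<open>p\<close>, unless some of them equal the grid point \<open>c\<close>.
\<close>

definition negligible_gap ::
    "(nat \<Rightarrow> real) pmf \<Rightarrow> nat \<Rightarrow> real \<Rightarrow> nat \<Rightarrow> real \<Rightarrow> real \<Rightarrow> real \<Rightarrow> bool" where
  "negligible_gap \<mu> n p M c a x \<longleftrightarrow>
     measure_pmf.prob \<mu> {e. \<exists>j\<in>{1..n}. e j \<in> {a<..x}} \<le> p \<or>
     (\<forall>g::int. of_int g / 2 ^ M \<in> {a<..x} \<longrightarrow> of_int g / 2 ^ M = c)"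

lemma prob_ext_bid_mono:
  assumes "S \<subseteq> S'"
  shows "measure_pmf.prob \<mu> {e. \<exists>j\<in>{1..n}. e j \<in> S} \<le> measure_pmf.prob \<mu> {e. \<exists>j\<in>{1..n::nat}. e j \<in> S'}"
  using assms by (intro measure_pmf.finite_measure_mono) auto

lemma negligible_gap_mono:
  assumes "negligible_gap \<mu> n p M c a x" and "a \<le> a'"
  shows "negligible_gap \<mu> n p M c a' x"
proof -
  have sub: "{a'<..x} \<subseteq> {a<..x}" using assms(2) by auto
  from assms(1) show ?thesis
    unfolding negligible_gap_def
  proof
    assume "measure_pmf.prob \<mu> {e. \<exists>j\<in>{1..n}. e j \<in> {a<..x}} \<le> p"
    with prob_ext_bid_mono[OF sub, of \<mu> n]
    show "measure_pmf.prob \<mu> {e. \<exists>j\<in>{1..n}. e j \<in> {a'<..x}} \<le> p \<or>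
      (\<forall>g::int. of_int g / 2 ^ M \<in> {a'<..x} \<longrightarrow> of_int g / 2 ^ M = c)" by linarith
  qed (use sub in blast)
qed

text \<open>The exceptional point \<open>c\<close> lies outside \<open>{a<..x}\<close>, so it can be
  exchanged for any other.\<close>

lemma negligible_gap_below:
  assumes "negligible_gap \<mu> n p M c a x" and "x < c"
  shows "negligible_gap \<mu> n p M c' a x"
proof -
  have "of_int g / 2 ^ M \<noteq> c" if "of_int g / 2 ^ M \<in> {a<..x}" for g :: int
    using that by (intro less_imp_neq le_less_trans[OF _ assms(2)]) simp
  then show ?thesis using assms(1) unfolding negligible_gap_def by blast
qed

text \<open>Induction along the bisection. A leaf allows its own right endpoint as exceptional
  point, but whenever two halves are joined the midpoint ceases to be exceptional, so only the right
  end \<beta> of the whole interval survives.\<close>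

lemma Rec_left_endpoint:
  fixes z :: int
  assumes "\<alpha> = of_int z / 2 ^ s" and "\<beta> = (of_int z + 1) / 2 ^ s" and "s \<le> M"
    and "\<eta> = 1 / 2 ^ M"
  shows "finite (Rec \<mu> n p \<eta> (\<alpha>, \<beta>)) \<and> \<alpha> \<in> fst ` Rec \<mu> n p \<eta> (\<alpha>, \<beta>) \<and>
    (\<forall>x\<in>{\<alpha>..\<beta>}. \<exists>a\<in>fst ` Rec \<mu> n p \<eta> (\<alpha>, \<beta>). a \<le> x \<and> negligible_gap \<mu> n p M \<beta> a x)"
  using assms
proof (induction "M - s" arbitrary: s \<alpha> \<beta> z rule: less_induct)
  case less
  let ?prob = "measure_pmf.prob \<mu> {e. \<exists>j\<in>{1..n}. e j \<in> {\<alpha><..\<beta>}}"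
  have "0 < \<eta>" using less.prems(4) by simp
  have width: "\<beta> - \<alpha> = 1 / 2 ^ s"
    using less.prems(1,2) by (simp add: add_divide_distrib)
  show ?case
  proof (cases "?prob \<le> p \<or> \<beta> - \<alpha> \<le> \<eta>")
    case True
    then have R: "Rec \<mu> n p \<eta> (\<alpha>, \<beta>) = {(\<alpha>, \<beta>)}"
      by (subst Rec.simps) auto
    have "negligible_gap \<mu> n p M \<beta> \<alpha> x" if x: "x \<in> {\<alpha>..\<beta>}" for x
    proof (cases "?prob \<le> p")
      case True
      have "{\<alpha><..x} \<subseteq> {\<alpha><..\<beta>}" using x by auto
      from prob_ext_bid_mono[OF this, of \<mu> n] True show ?thesis
        unfolding negligible_gap_def by linarith
    next
      case False
      \<comment> \<open>A leaf that is not explained by a small probability has the finest width,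
        and then \<beta> is the only grid point in \<open>{\<alpha><..\<beta>}\<close>.\<close>
      then have "1 / 2 ^ s \<le> \<eta>"
        using \<open>?prob \<le> p \<or> \<beta> - \<alpha> \<le> \<eta>\<close> width by linarith
      then have "(1 / 2 ^ s :: real) \<le> 1 / 2 ^ M"
        using less.prems(4) by simp
      then have "(2::real) ^ M \<le> 2 ^ s" by (simp add: divide_simps)
      then have "s = M" using less.prems(3) by simp
      show ?thesis
        unfolding negligible_gap_def
      proof (intro disjI2 allI impI)
        fix g :: int
        assume "of_int g / 2 ^ M \<in> {\<alpha><..x}"
        then have "of_int z < (of_int g :: real)" "(of_int g :: real) \<le> of_int z + 1"
          using x less.prems(1,2) \<open>s = M\<close> by (auto simp: divide_simps)
        then have "g = z + 1" by linarith
        then show "of_int g / 2 ^ M = \<beta>" using less.prems(2) \<open>s = M\<close> by simp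
      qed
    qed
    then show ?thesis by (simp add: R)
  next
    case False
    then have "1 / 2 ^ M < (1 / 2 ^ s :: real)" using less.prems(4) width by simp
    then have "s \<noteq> M" by blast
    then have s: "M - Suc s < M - s" "Suc s \<le> M" using less.prems(3) by auto
    let ?m = "(\<alpha> + \<beta>) / 2"
    let ?L = "Rec \<mu> n p \<eta> (\<alpha>, ?m)" and ?R = "Rec \<mu> n p \<eta> (?m, \<beta>)"
    have R: "Rec \<mu> n p \<eta> (\<alpha>, \<beta>) = ?L \<union> ?R"
      using False \<open>0 < \<eta>\<close> by (subst Rec.simps) auto
    note mid = dyadic_half[OF less.prems(1,2)]
    note L = less.hyps[OF s(1) mid(1,2) s(2) less.prems(4)]
    note Rt = less.hyps[OF s(1) mid(3,4) s(2) less.prems(4)]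
    show ?thesis
      unfolding R
    proof (intro conjI ballI)
      show "finite (?L \<union> ?R)" "\<alpha> \<in> fst ` (?L \<union> ?R)"
        using L Rt by (simp_all add: image_Un)
      fix x assume x: "x \<in> {\<alpha>..\<beta>}"
      show "\<exists>a\<in>fst ` (?L \<union> ?R). a \<le> x \<and> negligible_gap \<mu> n p M \<beta> a x"
      \<comment> \<open>The midpoint itself is assigned to the right half. The inequality in the
        left half is therefore strict, and \<open>negligible_gap_below\<close> replaces
        \<open>?m\<close> by \<beta>.\<close>
      proof (cases "x < ?m")
        case True
        with x have "x \<in> {\<alpha>..?m}" by simp
        with L obtain a where "a \<in> fst ` ?L" "a \<le> x" "negligible_gap \<mu> n p M ?m a x" by blast
        then show ?thesis
          using negligible_gap_below[OF _ True] unfolding image_Un by blast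
      next
        case False
        with x have "x \<in> {?m..\<beta>}" by simp
        with Rt show ?thesis unfolding image_Un by blast
      qed
    qed
  qed
qed

text \<open>Each bid goes to the largest left endpoint not above it. Rounding may create ties, so
  the levels record the order under \<open>b\<close>.\<close>

lemma exists_coarsening:
  assumes b: "b \<in> real_strategies A"
  obtains d where "d \<in> disc_strategies A p" and "coarsens A d b"
    and "\<And>i. i \<in> {1..nc A} \<Longrightarrow> negligible_gap (ext A) (ne A) p (bits A) 1 (fst (d i)) (fst (b i))"
proof -
  let ?D = "fst ` intervals A p"
  define \<rho> where "\<rho> x = Max {a \<in> ?D. a \<le> x}" for x
  \<comment> \<open>The root interval is the dyadic cell with \<open>z = 0\<close> and
    \<open>s = 0\<close>, hence the exceptional point is 1. Finiteness and the endpoint 0 make the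
    maximum in \<rho> well defined.\<close>
  have D: "finite (intervals A p)" "0 \<in> ?D"
    and ex: "\<And>x. x \<in> {0..1} \<Longrightarrow>
      \<exists>a\<in>?D. a \<le> x \<and> negligible_gap (ext A) (ne A) p (bits A) 1 a x"
    using Rec_left_endpoint[of 0 0 0 1 "bits A" "1 / 2 ^ bits A" "ext A" "ne A" p]
    by (simp_all add: intervals_def)
  have \<rho>_in: "\<rho> x \<in> ?D" "\<rho> x \<le> x" if "0 \<le> x" for x
  proof -
    have "\<rho> x \<in> {a \<in> ?D. a \<le> x}"
      unfolding \<rho>_def
    proof (rule Max_in)
      show "{a \<in> ?D. a \<le> x} \<noteq> {}" using D(2) that by blast
    qed (use D(1) in simp)
    then show "\<rho> x \<in> ?D" "\<rho> x \<le> x" by auto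
  qed
  have \<rho>_ge: "a \<le> \<rho> x" if "a \<in> ?D" "a \<le> x" for a x
    unfolding \<rho>_def using D that by (intro Max_ge) auto
  have \<rho>_mono: "\<rho> x \<le> \<rho> y" if "0 \<le> x" "x \<le> y" for x y
    using \<rho>_in[OF that(1)] that by (intro \<rho>_ge) auto
  have b01: "0 \<le> fst (b i)" "fst (b i) \<le> 1" "snd (b i) = 0" if "i \<in> {1..nc A}" for i
    using PiE_mem[OF b[unfolded real_strategies_def] that] by auto
  define beats where "beats i i' \<longleftrightarrow> fst (b i) > fst (b i') \<or> fst (b i) = fst (b i') \<and> i < i'"
    for i i' :: nat
  \<comment> \<open>Counting \<open>i\<close> itself keeps the level in \<open>{1..nc A}\<close>, as
    \<open>disc_bids\<close> demands.\<close>
  define lev where "lev i = card {i' \<in> {1..nc A}. i' = i \<or> beats i i'}" for i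
  have lev_range: "lev i \<in> {1..nc A}" if "i \<in> {1..nc A}" for i
  proof -
    have "card {i} \<le> lev i"
      unfolding lev_def using that by (intro card_mono) auto
    moreover have "lev i \<le> card {1..nc A}"
      unfolding lev_def by (intro card_mono) auto
    ultimately show ?thesis by simp
  qed
  have lev_less: "lev i' < lev i" if "i \<in> {1..nc A}" "beats i i'" for i i'
    unfolding lev_def
  proof (intro psubset_card_mono psubsetI)
    show "{k \<in> {1..nc A}. k = i' \<or> beats i' k} \<subseteq> {k \<in> {1..nc A}. k = i \<or> beats i k}"
      using that(2) by (auto simp: beats_def)
    have "i \<notin> {k \<in> {1..nc A}. k = i' \<or> beats i' k}"
      using that(2) by (auto simp: beats_def)
    then show "{k \<in> {1..nc A}. k = i' \<or> beats i' k} \<noteq> {k \<in> {1..nc A}. k = i \<or> beats i k}"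
      using that(1) by blast
  qed simp
  define d where "d = restrict (\<lambda>i. (\<rho> (fst (b i)), lev i)) {1..nc A}"
  have d: "d i = (\<rho> (fst (b i)), lev i)" if "i \<in> {1..nc A}" for i
    using that by (simp add: d_def)
  show thesis
  proof
    show "d \<in> disc_strategies A p"
      unfolding disc_strategies_def d_def
    proof (intro restrict_PiE_iff[THEN iffD2] ballI)
      fix i assume i: "i \<in> {1..nc A}"
      then obtain \<beta> where "(\<rho> (fst (b i)), \<beta>) \<in> intervals A p"
        using \<rho>_in(1)[OF b01(1)[OF i]] by force
      then show "(\<rho> (fst (b i)), lev i) \<in> disc_bids A p"
        unfolding disc_bids_def using lev_range[OF i] by blast
    qed
    \<comment> \<open>Rounding is monotone, so values cannot cross; where they coincide, the
      strictly larger level decides.\<close>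
    have fwd: "outranks d e (Inl i') (Inl i)"
      if "outranks b e (Inl i') (Inl i)" "i \<in> {1..nc A}" "i' \<in> {1..nc A}" for i i' e
    proof -
      have "beats i' i" using that b01 by (auto simp: beats_def)
      moreover from this have "\<rho> (fst (b i)) \<le> \<rho> (fst (b i'))"
        using b01(1)[OF that(2)] by (intro \<rho>_mono) (auto simp: beats_def)
      ultimately show ?thesis using lev_less[of i' i] that by (auto simp: d)
    qed
    \<comment> \<open>The converse comes from \<open>fwd\<close>: the order under \<open>b\<close>
      is total on distinct colluders and the one under \<open>d\<close> is asymmetric.\<close>
    have bwd: "outranks b e (Inl i') (Inl i)"
      if "outranks d e (Inl i') (Inl i)" "i \<in> {1..nc A}" "i' \<in> {1..nc A}" for i i' e
    proof (rule ccontr)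
      assume "\<not> outranks b e (Inl i') (Inl i)"
      moreover have "i \<noteq> i'" using that(1) by auto
      ultimately have "outranks b e (Inl i) (Inl i')" using b01 that(2,3) by auto
      from fwd[OF this that(3,2)] that(1) show False by auto
    qed
    show "coarsens A d b"
      unfolding coarsens_def
    proof (intro conjI ballI allI iffI)
      fix i assume i: "i \<in> {1..nc A}"
      show "0 \<le> fst (d i)" using \<rho>_ge[OF D(2) b01(1)[OF i]] by (simp add: d[OF i])
      show "fst (d i) \<le> fst (b i)" using \<rho>_in(2)[OF b01(1)[OF i]] by (simp add: d[OF i])
      show "fst (b i) \<le> 1" by (rule b01(2)[OF i])
    qed (rule fwd bwd; assumption)+
    fix i assume i: "i \<in> {1..nc A}"
    have "fst (b i) \<in> {0..1}" using b01[OF i] by simp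
    \<comment> \<open>Some left endpoint has a negligible gap, and \<rho>, being the largest
      candidate, only shrinks it.\<close>
    from ex[OF this] show "negligible_gap (ext A) (ne A) p (bits A) 1 (fst (d i)) (fst (b i))"
      using \<rho>_ge by (auto simp: d[OF i] intro: negligible_gap_mono)
  qed
qed

section \<open>From single external profiles to expectations\<close>

text \<open>The grid is finite. Consequently every function of the external profile is integrable,
  and expectations are finite sums.\<close>

lemma finite_support:
  assumes "auction_ok A"
  shows "finite (set_pmf (ext A))"
proof -
  let ?G = "{x::real. 0 \<le> x \<and> x \<le> 1 \<and> (\<exists>z::int. x = of_int z / 2 ^ bits A)}"
  have "?G \<subseteq> (\<lambda>z. of_int z / 2 ^ bits A) ` {0..2 ^ bits A}"
  proof
    fix x assume "x \<in> ?G"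
    then obtain z :: int where z: "x = of_int z / 2 ^ bits A" "0 \<le> x" "x \<le> 1" by auto
    then have zx: "of_int z = x * 2 ^ bits A" by simp
    have "(of_int 0 :: real) \<le> of_int z" unfolding zx using z(2) by simp
    moreover have "(of_int z :: real) \<le> of_int (2 ^ bits A)" unfolding zx using z(3) by simp
    ultimately have "z \<in> {0..2 ^ bits A}" by (simp only: of_int_le_iff atLeastAtMost_iff)
    with z show "x \<in> (\<lambda>z. of_int z / 2 ^ bits A) ` {0..2 ^ bits A}" by blast
  qed
  then have "finite ?G" by (rule finite_subset) simp
  then have "finite (ext_grid A)" unfolding ext_grid_def by (intro finite_PiE) auto
  with assms show ?thesis unfolding auction_ok_def by (blast intro: finite_subset)
qed

lemma exp_utility_eq:
  assumes "auction_ok A"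
  shows "exp_revenue A b i - exp_payment mech A b i
    = measure_pmf.expectation (ext A) (\<lambda>e. utility mech A b e i)"
  unfolding exp_revenue_def exp_payment_def utility_def
  by (intro Bochner_Integration.integral_diff[symmetric] integrable_measure_pmf_finite
      finite_support assms)

lemma ext_grid_of_support:
  assumes "auction_ok A" and "e \<in> set_pmf (ext A)" and "j \<in> {1..ne A}"
  shows "0 \<le> e j" and "e j \<le> 1" and "\<exists>z::int. e j = of_int z / 2 ^ bits A"
  using assms PiE_mem[of e "{1..ne A}" "\<lambda>_. {x. 0 \<le> x \<and> x \<le> 1 \<and> (\<exists>z::int. x = of_int z / 2 ^ bits A)}" j]
  unfolding auction_ok_def ext_grid_def by auto

lemma surplus_discretize:
  assumes ok: "auction_ok A" and b: "b \<in> real_strategies A" and "0 \<le> p"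
  obtains d where "d \<in> disc_strategies A p" and "surplus mech A b - p * real (nc A) \<le> surplus mech A d"
proof -
  obtain d where d: "d \<in> disc_strategies A p" "coarsens A d b"
    and rare: "\<And>i. i \<in> {1..nc A} \<Longrightarrow> negligible_gap (ext A) (ne A) p (bits A) 1 (fst (d i)) (fst (b i))"
    using exists_coarsening[OF b] by blast
  note int = integrable_measure_pmf_finite[OF finite_support[OF ok]]
  note supp = ext_grid_of_support[OF ok]
  let ?E = "measure_pmf.expectation (ext A)"
  have "?E (\<lambda>e. utility mech A b e i) - p \<le> ?E (\<lambda>e. utility mech A d e i)"
    if i: "i \<in> {1..nc A}" for i
  proof -
    let ?H = "{e. \<exists>j\<in>{1..ne A}. e j \<in> {fst (d i)<..fst (b i)}}"
    note cmp = utility_coarsens[OF ok d(2) i]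
    from rare[OF i] show ?thesis
      unfolding negligible_gap_def
    proof
      assume p: "measure_pmf.prob (ext A) ?H \<le> p"
      \<comment> \<open>The indicator of \<open>?H\<close> dominates the loss: at most 1 when an
        external bid falls into the gap, and 0 otherwise.\<close>
      have "?E (\<lambda>e. utility mech A b e i) - measure_pmf.prob (ext A) ?H
          = ?E (\<lambda>e. utility mech A b e i - indicator ?H e)"
        using int by (subst Bochner_Integration.integral_diff) simp_all
      also have "\<dots> \<le> ?E (\<lambda>e. utility mech A d e i)"
      proof (intro integral_mono_AE int AE_pmfI)
        fix e assume e: "e \<in> set_pmf (ext A)"
        show "utility mech A b e i - indicator ?H e \<le> utility mech A d e i"
        proof (cases "e \<in> ?H")
          case True
          then show ?thesis using cmp(1)[of e mech] supp[OF e] by simp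
        next
          case False
          then have "utility mech A b e i \<le> utility mech A d e i"
            by (intro cmp(2)) (use supp[OF e] in auto)
          with False show ?thesis by simp
        qed
      qed
      finally show ?thesis using p by simp
    next
      assume g: "\<forall>g::int. of_int g / 2 ^ bits A \<in> {fst (d i)<..fst (b i)}
        \<longrightarrow> of_int g / 2 ^ bits A = (1::real)"
      have "?E (\<lambda>e. utility mech A b e i) \<le> ?E (\<lambda>e. utility mech A d e i)"
      proof (intro integral_mono_AE int AE_pmfI)
        fix e assume e: "e \<in> set_pmf (ext A)"
        show "utility mech A b e i \<le> utility mech A d e i"
        proof (intro cmp(2))
          \<comment> \<open>Bids in the support are grid points, so \<open>g\<close> applies to
            them.\<close>
          fix j assume "j \<in> {1..ne A}" "e j \<in> {fst (d i)<..fst (b i)}"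
          then show "e j = 1" using supp(3)[OF e] g by metis
        qed (use supp[OF e] in auto)
      qed
      with \<open>0 \<le> p\<close> show ?thesis by simp
    qed
  qed
  then have "(\<Sum>i\<in>{1..nc A}. ?E (\<lambda>e. utility mech A b e i) - p)
      \<le> (\<Sum>i\<in>{1..nc A}. ?E (\<lambda>e. utility mech A d e i))"
    by (intro sum_mono)
  then have "surplus mech A b - p * real (nc A) \<le> surplus mech A d"
    unfolding surplus_def exp_utility_eq[OF ok] by (simp add: sum_subtractf mult.commute)
  with d(1) show thesis by (rule that)
qed

section \<open>Measurability and the optimal value\<close>

abbreviation strategy_space :: "auction \<Rightarrow> strategy measure" where
  "strategy_space A \<equiv> PiM {1..nc A} (\<lambda>_. restrict_space (borel :: bid measure) ({0..1} \<times> {0}))"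

lemma space_strategy_space: "space (strategy_space A) = real_strategies A"
  by (simp add: space_PiM space_restrict_space real_strategies_def)

lemma measurable_strategy_space_fst:
  assumes "i \<in> {1..nc A}"
  shows "(\<lambda>b. fst (b i)) \<in> borel_measurable (strategy_space A)"
proof -
  have "fst \<in> borel_measurable (restrict_space (borel :: bid measure) ({0..1} \<times> {0}))"
    by (intro measurable_restrict_space1 borel_measurable_continuous_onI continuous_on_fst
        continuous_on_id)
  from measurable_compose[OF measurable_component_singleton[OF assms] this]
  show ?thesis by simp
qed

lemma measurable_bid_value:
  assumes "a \<in> agents A"
  shows "(\<lambda>b. bid_value b e a) \<in> borel_measurable (strategy_space A)"
  using assms measurable_strategy_space_fst[of _ A]
  by (cases a) (auto simp: bid_value_def agents_def)

text \<open>A cardinality is a finite sum of 0-1 functions. Ranks and the counts behind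
  \<open>kth_bid\<close> have this form.\<close>

lemma measurable_card_filter:
  assumes "finite F" and "\<And>a. a \<in> F \<Longrightarrow> Measurable.pred M (P a)"
  shows "(\<lambda>x. card {a \<in> F. P a x}) \<in> measurable M (count_space UNIV)"
proof -
  have "card {a \<in> F. P a x} = (\<Sum>a\<in>F. if P a x then 1 else 0)" for x
    using assms(1) by (simp add: sum.If_cases Int_def)
  moreover have "(\<lambda>x. \<Sum>a\<in>F. if P a x then 1 else 0 :: nat) \<in> borel_measurable M"
    using assms(2) by (intro borel_measurable_sum measurable_If) auto
  ultimately show ?thesis
    by (simp add: measurable_cong_sets[OF refl sets_borel_eq_count_space])
qed

lemma measurable_outranks:
  assumes a: "a \<in> agents A" and i: "i \<in> {1..nc A}"
  shows "Measurable.pred (strategy_space A) (\<lambda>b. outranks b e a (Inl i))"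
proof (cases a)
  case (Inl i')
  with a have i': "i' \<in> {1..nc A}" by (auto simp: agents_def)
  \<comment> \<open>All levels are 0 on \<open>real_strategies\<close>, so the order among colluders
    is a condition on real coordinates and indices only.\<close>
  have "Measurable.pred (strategy_space A) (\<lambda>b. outranks b e a (Inl i)) \<longleftrightarrow>
    Measurable.pred (strategy_space A)
      (\<lambda>b. fst (b i) < fst (b i') \<or> \<not> fst (b i') < fst (b i) \<and> i' < i)"
  proof (rule measurable_cong)
    fix b assume "b \<in> space (strategy_space A)"
    then have b: "b \<in> {1..nc A} \<rightarrow>\<^sub>E {0..1} \<times> {0}"
      unfolding space_strategy_space real_strategies_def .
    have "snd (b i) = snd (b i')"
      using PiE_mem[OF b i] PiE_mem[OF b i'] by auto
    then show "outranks b e a (Inl i) \<longleftrightarrow>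
        fst (b i) < fst (b i') \<or> \<not> fst (b i') < fst (b i) \<and> i' < i"
      using Inl by auto
  qed
  moreover have "Measurable.pred (strategy_space A) (\<lambda>b. f b < g b \<or> \<not> g b < f b \<and> c)"
    if [measurable]: "f \<in> borel_measurable (strategy_space A)" "g \<in> borel_measurable (strategy_space A)"
    for f g :: "strategy \<Rightarrow> real" and c
    by measurable
  ultimately show ?thesis
    using measurable_strategy_space_fst[OF i] measurable_strategy_space_fst[OF i'] by blast
next
  case (Inr j)
  have "Measurable.pred (strategy_space A) (\<lambda>b. f b < c)"
    if [measurable]: "f \<in> borel_measurable (strategy_space A)" for f :: "strategy \<Rightarrow> real" and c
    by measurable
  with Inr measurable_strategy_space_fst[OF i] show ?thesis by simp
qed

lemma measurable_rank_of:
  assumes "i \<in> {1..nc A}"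
  shows "(\<lambda>b. rank_of A b e (Inl i)) \<in> measurable (strategy_space A) (count_space UNIV)"
  unfolding rank_of_def
proof (rule measurable_compose[OF measurable_card_filter])
  show "Measurable.pred (strategy_space A) (\<lambda>b. outranks b e a (Inl i))" if "a \<in> agents A" for a
    using that assms by (rule measurable_outranks)
qed simp_all

text \<open>By \<open>kth_bid_ge_iff\<close>, superlevel sets are conditions on a measurable
  count.\<close>

lemma measurable_kth_bid: "(\<lambda>b. kth_bid A b e k) \<in> borel_measurable (strategy_space A)"
proof (cases "1 \<le> k \<and> k \<le> nc A + ne A")
  case True
  have "{b \<in> space (strategy_space A). c \<le> kth_bid A b e k} \<in> sets (strategy_space A)" for c
  proof -
    have "(\<lambda>b. card {a \<in> agents A. c \<le> bid_value b e a})
        \<in> measurable (strategy_space A) (count_space UNIV)"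
    proof (intro measurable_card_filter)
      fix a assume "a \<in> agents A"
      note [measurable] = measurable_bid_value[OF this, of e]
      show "Measurable.pred (strategy_space A) (\<lambda>b. c \<le> bid_value b e a)" by measurable
    qed simp
    note [measurable] = this
    have "{b \<in> space (strategy_space A). k \<le> card {a \<in> agents A. c \<le> bid_value b e a}}
        \<in> sets (strategy_space A)" by measurable
    then show ?thesis using True by (simp add: kth_bid_ge_iff)
  qed
  then show ?thesis by (simp add: borel_measurable_iff_ge)
next
  case False
  then have "kth_bid A b e k = 0" for b by (rule kth_bid_outside)
  then show ?thesis by simp
qed

lemma measurable_revenue:
  assumes "i \<in> {1..nc A}"
  shows "(\<lambda>b. revenue A b e i) \<in> borel_measurable (strategy_space A)"
  unfolding revenue_def
  by (rule measurable_compose[OF measurable_rank_of[OF assms]]) simp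

text \<open>The rank is a measurable function with countably many values, so it may be held
  fixed.\<close>

lemma measurable_payment:
  assumes "i \<in> {1..nc A}"
  shows "(\<lambda>b. payment mech A b e i) \<in> borel_measurable (strategy_space A)"
  unfolding payment_eq_charge
proof (rule measurable_compose_countable[OF _ measurable_rank_of[OF assms]])
  fix k
  show "(\<lambda>b. charge mech A (kth_bid A b e) k) \<in> borel_measurable (strategy_space A)"
    by (cases mech) (auto simp only: charge_def mechanism.case intro!: borel_measurable_times
        borel_measurable_sum borel_measurable_const measurable_kth_bid)
qed

lemma measurable_expectation_finite_pmf:
  fixes f :: "'a \<Rightarrow> 'b \<Rightarrow> real"
  assumes "finite (set_pmf \<mu>)" and "\<And>e. (\<lambda>b. f b e) \<in> borel_measurable M"
  shows "(\<lambda>b. measure_pmf.expectation \<mu> (f b)) \<in> borel_measurable M"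
  using assms by (simp add: integral_measure_pmf[OF assms(1)])

lemma measurable_exp_revenue:
  assumes "auction_ok A" and "i \<in> {1..nc A}"
  shows "(\<lambda>b. exp_revenue A b i) \<in> borel_measurable (strategy_space A)"
  unfolding exp_revenue_def
  by (intro measurable_expectation_finite_pmf finite_support measurable_revenue assms)

lemma measurable_exp_payment:
  assumes "auction_ok A" and "i \<in> {1..nc A}"
  shows "(\<lambda>b. exp_payment mech A b i) \<in> borel_measurable (strategy_space A)"
  unfolding exp_payment_def
  by (intro measurable_expectation_finite_pmf finite_support measurable_payment assms)

section \<open>Bounding the optimal value\<close>

text \<open>Revenue and charge both lie between 0 and 1. The bound supplies the integrability needed
  to exchange sum and integral in \<open>agency_value\<close>.\<close>

lemma exp_utility_bounds:
  assumes ok: "auction_ok A" and b: "b \<in> real_strategies A" and i: "i \<in> {1..nc A}"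
  shows "\<bar>exp_revenue A b i - exp_payment mech A b i\<bar> \<le> 1"
proof -
  have "\<bar>utility mech A b e i\<bar> \<le> 1" if e: "e \<in> set_pmf (ext A)" for e
  proof -
    let ?k = "rank_of A b e (Inl i)"
    have b01: "0 \<le> fst (b i')" "fst (b i') \<le> 1" if "i' \<in> {1..nc A}" for i'
      using PiE_mem[OF b[unfolded real_strategies_def] that] by auto
    have bnd: "0 \<le> bid_value b e a \<and> bid_value b e a \<le> 1" if "a \<in> agents A" for a
      using that b01 ext_grid_of_support(1,2)[OF ok e] by (auto simp: agents_def bid_value_def)
    have k: "1 \<le> ?k" by (simp add: rank_of_def)
    have v: "0 \<le> val A i" "val A i \<le> 1" using ok i by (auto simp: auction_ok_def)
    then have "0 \<le> revenue A b e i" "revenue A b e i \<le> 1"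
      unfolding revenue_def using ctr_bounds[OF ok k] by (auto intro: mult_le_one)
    \<comment> \<open>With unchanged rank and \<open>c = 0\<close>, \<open>charge_diff_ge\<close>
      says that the charge is monotone in the sorted bids; constant bids 0 and 1 give the two
      bounds.\<close>
    moreover have "charge mech A (\<lambda>_. 0) ?k \<le> charge mech A (kth_bid A b e) ?k"
      using charge_diff_ge[where c = 0, OF ok k order_refl kth_bid_bounds(1)[OF bnd]
          kth_bid_antimono[OF bnd]] by simp
    moreover have "charge mech A (\<lambda>_. 0) ?k = 0"
      by (cases mech) (simp_all add: charge_def)
    moreover have "charge mech A (kth_bid A b e) ?k \<le> charge mech A (\<lambda>_. 1) ?k"
      using charge_diff_ge[where B = "\<lambda>_. 1" and c = 0, OF ok k order_refl kth_bid_bounds(2)[OF bnd]] by simp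
    moreover have "charge mech A (\<lambda>_. 1) ?k \<le> 1"
    proof (cases mech)
      case VCG
      \<comment> \<open>With all bids equal to 1 the VCG charge telescopes.\<close>
      have "(\<Sum>j\<in>{?k + 1..?k + n}. ctr A (j - 1) - ctr A j) = ctr A ?k - ctr A (?k + n)" for n
        by (induction n) simp_all
      from this[of "slots A + 1 - ?k"] show ?thesis
        using VCG ctr_bounds[OF ok k] ctr_bounds(1)[OF ok, of "slots A + 1"]
        by (cases "?k \<le> slots A + 1") (simp_all add: charge_def)
    qed (use ctr_bounds[OF ok k] in \<open>simp add: charge_def\<close>)
    ultimately show ?thesis by (simp add: utility_def payment_eq_charge)
  qed
  then have "AE e in ext A. \<bar>utility mech A b e i\<bar> \<le> 1" by (intro AE_pmfI)
  moreover note int = integrable_measure_pmf_finite[OF finite_support[OF ok]]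
  ultimately have "measure_pmf.expectation (ext A) (\<lambda>e. \<bar>utility mech A b e i\<bar>) \<le> 1"
    by (intro measure_pmf.integral_le_const)
  then show ?thesis
    unfolding exp_utility_eq[OF ok]
    using integral_abs_bound[of "ext A" "\<lambda>e. utility mech A b e i"] by linarith
qed

text \<open>Randomizing cannot beat the best pure strategy, because the agency value is an average
  of surpluses.\<close>

lemma agency_value_le:
  assumes ok: "auction_ok A" and \<gamma>: "\<gamma> \<in> real_strategy_dists A"
    and bound: "\<And>b. b \<in> real_strategies A \<Longrightarrow> surplus mech A b \<le> c"
  shows "agency_value mech A \<gamma> \<le> c"
proof -
  interpret prob_space \<gamma> using \<gamma> by (simp add: real_strategy_dists_def)
  have sets: "sets \<gamma> = sets (strategy_space A)" using \<gamma> by (simp add: real_strategy_dists_def)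
  then have space: "space \<gamma> = real_strategies A"
    using sets_eq_imp_space_eq space_strategy_space by metis
  have int: "integrable \<gamma> (\<lambda>b. exp_revenue A b i - exp_payment mech A b i)"
    if "i \<in> {1..nc A}" for i
  proof (rule integrable_const_bound[where B = 1])
    show "AE b in \<gamma>. norm (exp_revenue A b i - exp_payment mech A b i) \<le> 1"
      using exp_utility_bounds[OF ok _ that] space by (intro AE_I2) simp
    show "(\<lambda>b. exp_revenue A b i - exp_payment mech A b i) \<in> borel_measurable \<gamma>"
      unfolding measurable_cong_sets[OF sets refl]
      by (intro borel_measurable_diff measurable_exp_revenue measurable_exp_payment ok that)
  qed
  then have "agency_value mech A \<gamma> = (\<integral>b. surplus mech A b \<partial>\<gamma>)"
    unfolding agency_value_def surplus_def by (intro Bochner_Integration.integral_sum[symmetric])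
  also have "\<dots> \<le> c"
    using int bound space unfolding surplus_def
    by (intro integral_le_const integrable_sum AE_I2) auto
  finally show ?thesis .
qed

lemma OPT_le:
  assumes ok: "auction_ok A" and b: "b \<in> real_strategies A"
    and feasible: "\<And>i. i \<in> {1..nc A} \<Longrightarrow> tgt A i \<le> exp_revenue A b i - exp_payment mech A b i"
    and bound: "\<And>b. b \<in> real_strategies A \<Longrightarrow> surplus mech A b \<le> c"
  shows "OPT mech A \<le> c"
  unfolding OPT_def
proof (rule cSup_least)
  \<comment> \<open>\<open>cSup_least\<close> needs a nonempty set. The point mass at the feasible
    strategy, with transfers that make IC tight, satisfies IR by \<open>feasible\<close>.\<close>
  let ?\<gamma> = "return (strategy_space A) b" and ?q = "\<lambda>i. exp_revenue A b i - tgt A i"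
  have space: "b \<in> space (strategy_space A)" using b unfolding space_strategy_space .
  then have "?\<gamma> \<in> real_strategy_dists A"
    by (simp add: real_strategy_dists_def prob_space_return)
  moreover have "IC A ?\<gamma> ?q"
    unfolding approx_IC_def
  proof
    fix i assume "i \<in> {1..nc A}"
    from integral_return[OF space measurable_exp_revenue[OF ok this]]
    show "(\<integral>b. exp_revenue A b i \<partial>?\<gamma>) - ?q i \<ge> tgt A i - 0" by linarith
  qed
  moreover have "IR mech A ?\<gamma> ?q"
    unfolding IR_def
  proof (rule sum_mono)
    fix i assume i: "i \<in> {1..nc A}"
    from integral_return[OF space measurable_exp_payment[OF ok i, of mech]] feasible[OF i]
    show "(\<integral>b. exp_payment mech A b i \<partial>?\<gamma>) \<le> ?q i" by linarith
  qed
  ultimately show "{agency_value mech A \<gamma> | \<gamma> q.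
      \<gamma> \<in> real_strategy_dists A \<and> IC A \<gamma> q \<and> IR mech A \<gamma> q} \<noteq> {}"
    by blast
qed (use agency_value_le[OF ok _ bound] in blast)

section \<open>The program\<close>

definition copy_and_transfer_step :: com where
  "copy_and_transfer_step =
     Seq (QueryRevenue ''r'' ''bid'' ''level'' ''i'')
    (Seq (Load ''x'' ''t'' ''i'')
    (Seq (Sub ''r'' ''r'' ''x'')
    (Seq (Add ''r'' ''r'' ''p'')
    (Seq (Store ''q'' ''i'' ''r'')
    (Seq (Load ''x'' ''bid'' ''i'')
    (Seq (Store ''gamma_bid'' ''i'' ''x'')
    (Seq (Load ''x'' ''level'' ''i'')
    (Seq (Store ''gamma_level'' ''i'' ''x'')
         (Add ''i'' ''i'' ''K'')))))))))"

text \<open>The output cell \<open>K\<close> holds 1 throughout and doubles as the loop increment.\<close>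

definition transfer_program :: com where
  "transfer_program =
     Seq (Const ''K'' 1)
    (Seq (Const ''i'' 1)
    (Seq (Store ''gamma_prob'' ''i'' ''K'')
         (WhileLe ''i'' ''nc'' copy_and_transfer_step)))"

text \<open>Loop invariant after \<open>k\<close> iterations: the cells still to be read are intact,
  and the outputs of the first \<open>k\<close> colluders are in place.\<close>

definition progress :: "auction \<Rightarrow> real \<Rightarrow> strategy \<Rightarrow> nat \<Rightarrow> state \<Rightarrow> bool" where
  "progress A p b k s \<longleftrightarrow>
     scalar s ''K'' = 1 \<and> scalar s ''i'' = real (Suc k) \<and>
     scalar s ''nc'' = real (nc A) \<and> scalar s ''p'' = p \<and>
     (\<forall>a\<in>{''t'', ''bid'', ''level''}. arr s a = init_arr A b a) \<and>
     arr s ''gamma_prob'' 1 = 1 \<and>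
     (\<forall>i\<in>{1..k}. arr s ''gamma_bid'' i = fst (b i) \<and> arr s ''gamma_level'' i = real (snd (b i)) \<and>
        arr s ''q'' i = exp_revenue A b i - tgt A i + p)"

lemma exec_copy_and_transfer_step:
  assumes "progress A p b k s" and "k < nc A" and "b \<in> S" and "b \<in> extensional {1..nc A}"
  obtains s' where "exec (nc A) S (exp_revenue A) P copy_and_transfer_step s 10 s'"
    and "progress A p b (Suc k) s'"
proof -
  note pr = assms(1)[unfolded progress_def]
  have sa: "strategy_at (nc A) s ''bid'' ''level'' 0 b"
    using pr assms(4) by (simp add: strategy_at_def init_arr_def)
  let ?r = "exp_revenue A b (Suc k)" and ?t = "tgt A (Suc k)"
  let ?x = "fst (b (Suc k))" and ?l = "real (snd (b (Suc k)))"
  \<comment> \<open>One state per instruction. \<open>Seq\<close> costs nothing itself, so the ten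
    instructions take 10 steps.\<close>
  define s1 where "s1 = set_scalar ''r'' ?r s"
  define s2 where "s2 = set_scalar ''x'' ?t s1"
  define s3 where "s3 = set_scalar ''r'' (?r - ?t) s2"
  define s4 where "s4 = set_scalar ''r'' (?r - ?t + p) s3"
  define s5 where "s5 = set_arr ''q'' (Suc k) (?r - ?t + p) s4"
  define s6 where "s6 = set_scalar ''x'' ?x s5"
  define s7 where "s7 = set_arr ''gamma_bid'' (Suc k) ?x s6"
  define s8 where "s8 = set_scalar ''x'' ?l s7"
  define s9 where "s9 = set_arr ''gamma_level'' (Suc k) ?l s8"
  define s10 where "s10 = set_scalar ''i'' (real (Suc k) + 1) s9"
  note sdefs = s1_def s2_def s3_def s4_def s5_def s6_def s7_def s8_def s9_def s10_def
    set_scalar_def set_arr_def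
  let ?E = "exec (nc A) S (exp_revenue A) P"
  have "?E (QueryRevenue ''r'' ''bid'' ''level'' ''i'') s 1 s1"
    unfolding s1_def by (rule exec.QueryRevenue[OF sa assms(3)]) (use pr assms(2) in auto)
  moreover have "?E (Load ''x'' ''t'' ''i'') s1 1 s2"
    using exec.Load[of s1 "''i''" "Suc k" "nc A" S "exp_revenue A" P "''x''" "''t''"] pr assms(2)
    by (simp add: sdefs init_arr_def)
  moreover have "?E (Sub ''r'' ''r'' ''x'') s2 1 s3"
    using exec.Sub[of "nc A" S "exp_revenue A" P "''r''" "''r''" "''x''" s2] by (simp add: sdefs)
  moreover have "?E (Add ''r'' ''r'' ''p'') s3 1 s4"
    using exec.Add[of "nc A" S "exp_revenue A" P "''r''" "''r''" "''p''" s3] pr by (simp add: sdefs)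
  moreover have "?E (Store ''q'' ''i'' ''r'') s4 1 s5"
    using exec.Store[of s4 "''i''" "Suc k" "nc A" S "exp_revenue A" P "''q''" "''r''"] pr
    by (simp add: sdefs)
  moreover have "?E (Load ''x'' ''bid'' ''i'') s5 1 s6"
    using exec.Load[of s5 "''i''" "Suc k" "nc A" S "exp_revenue A" P "''x''" "''bid''"] pr assms(2)
    by (simp add: sdefs init_arr_def)
  moreover have "?E (Store ''gamma_bid'' ''i'' ''x'') s6 1 s7"
    using exec.Store[of s6 "''i''" "Suc k" "nc A" S "exp_revenue A" P "''gamma_bid''" "''x''"] pr
    by (simp add: sdefs)
  moreover have "?E (Load ''x'' ''level'' ''i'') s7 1 s8"
    using exec.Load[of s7 "''i''" "Suc k" "nc A" S "exp_revenue A" P "''x''" "''level''"] pr assms(2)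
    by (simp add: sdefs init_arr_def)
  moreover have "?E (Store ''gamma_level'' ''i'' ''x'') s8 1 s9"
    using exec.Store[of s8 "''i''" "Suc k" "nc A" S "exp_revenue A" P "''gamma_level''" "''x''"] pr
    by (simp add: sdefs)
  moreover have "?E (Add ''i'' ''i'' ''K'') s9 1 s10"
    using exec.Add[of "nc A" S "exp_revenue A" P "''i''" "''i''" "''K''" s9] pr by (simp add: sdefs)
  ultimately have "?E copy_and_transfer_step s (1+(1+(1+(1+(1+(1+(1+(1+(1+1))))))))) s10"
    unfolding copy_and_transfer_step_def by (intro exec.Seq)
  then have "?E copy_and_transfer_step s 10 s10" by (simp add: numeral_eq_Suc)
  moreover have "progress A p b (Suc k) s10"
    using pr by (auto simp: progress_def sdefs atLeastAtMostSuc_conv)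
  ultimately show thesis by (rule that)
qed

text \<open>Each iteration costs 10 steps for the body and 1 for the guard; the last 1 is the
  failing guard.\<close>

lemma exec_copy_and_transfer_loop:
  assumes "progress A p b k s" and "k \<le> nc A" and "b \<in> S" and "b \<in> extensional {1..nc A}"
  shows "\<exists>s'. exec (nc A) S (exp_revenue A) P (WhileLe ''i'' ''nc'' copy_and_transfer_step) s
      (11 * (nc A - k) + 1) s' \<and> progress A p b (nc A) s'"
  using assms(1,2)
proof (induction "nc A - k" arbitrary: k s)
  case 0
  then have "\<not> scalar s ''i'' \<le> scalar s ''nc''" "k = nc A"
    by (auto simp: progress_def)
  moreover from this have "exec (nc A) S (exp_revenue A) P (WhileLe ''i'' ''nc'' copy_and_transfer_step) s 1 s"
    by (intro exec.WhileFalse)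
  ultimately show ?case using 0 by auto
next
  case (Suc n)
  then have "k < nc A" by simp
  with Suc.prems have le: "scalar s ''i'' \<le> scalar s ''nc''"
    by (simp add: progress_def)
  obtain s1 where s1: "exec (nc A) S (exp_revenue A) P copy_and_transfer_step s 10 s1"
    "progress A p b (Suc k) s1"
    using exec_copy_and_transfer_step[OF Suc.prems(1) \<open>k < nc A\<close> assms(3,4)] by blast
  have "n = nc A - Suc k" "Suc k \<le> nc A" using Suc.hyps(2) by auto
  with Suc.hyps(1) s1(2) obtain s2 where
    "exec (nc A) S (exp_revenue A) P (WhileLe ''i'' ''nc'' copy_and_transfer_step) s1
      (11 * (nc A - Suc k) + 1) s2" "progress A p b (nc A) s2" by blast
  moreover have "Suc (10 + (11 * (nc A - Suc k) + 1)) = 11 * (nc A - k) + 1"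
    using \<open>k < nc A\<close> by simp
  ultimately show ?case using exec.WhileTrue[OF le s1(1)] by metis
qed

lemma exec_transfer_program:
  assumes "b \<in> S" and "b \<in> extensional {1..nc A}"
  obtains s where "exec (nc A) S (exp_revenue A) P transfer_program (init_state A p b)
      (11 * nc A + 4) s" and "progress A p b (nc A) s"
proof -
  let ?E = "exec (nc A) S (exp_revenue A) P"
  let ?s0 = "init_state A p b"
  let ?s1 = "set_scalar ''K'' 1 ?s0"
  let ?s2 = "set_scalar ''i'' 1 ?s1"
  let ?s3 = "set_arr ''gamma_prob'' 1 1 ?s2"
  have "?E (Const ''K'' 1) ?s0 1 ?s1"
    using exec.Const[of "nc A" S "exp_revenue A" P "''K''" 1] by simp
  moreover have "?E (Const ''i'' 1) ?s1 1 ?s2"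
    using exec.Const[of "nc A" S "exp_revenue A" P "''i''" 1] by simp
  moreover have "?E (Store ''gamma_prob'' ''i'' ''K'') ?s2 1 ?s3"
    using exec.Store[of ?s2 "''i''" 1 "nc A" S "exp_revenue A" P "''gamma_prob''" "''K''"]
    by (simp add: set_scalar_def)
  moreover have "progress A p b 0 ?s3"
    by (auto simp: progress_def set_scalar_def set_arr_def init_state_def init_scalar_def fun_eq_iff)
  then obtain s where "?E (WhileLe ''i'' ''nc'' copy_and_transfer_step) ?s3 (11 * nc A + 1) s"
    and s: "progress A p b (nc A) s"
    using exec_copy_and_transfer_loop[of A p b 0 ?s3 S P] assms by auto
  ultimately have "?E transfer_program ?s0 (1 + (1 + (1 + (11 * nc A + 1)))) s"
    unfolding transfer_program_def by (intro exec.Seq)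
  then have "?E transfer_program ?s0 (11 * nc A + 4) s" by (simp add: numeral_eq_Suc)
  then show thesis using s by (rule that)
qed

text \<open>The output list is a single pair, so \<open>K\<close> is 1 and the only offset is
  0.\<close>

lemma outputs_progress:
  assumes "progress A p b (nc A) s" and "b \<in> extensional {1..nc A}"
  shows "outputs (nc A) s (return_pmf b) (\<lambda>i. exp_revenue A b i - tgt A i + p)"
  unfolding outputs_def
proof (intro conjI exI[of _ "[(b, 1 :: real)]"])
  show wf: "pmf_of_list_wf [(b, 1 :: real)]" by (rule pmf_of_list_wfI) simp_all
  show "return_pmf b = pmf_of_list [(b, 1 :: real)]"
    by (rule pmf_eqI) (simp add: pmf_pmf_of_list[OF wf] indicator_def)
qed (use assms in \<open>auto simp: progress_def strategy_at_def\<close>)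

theorem lemma6:
  fixes mech :: mechanism
  shows "\<exists>(prog :: com) (time_bound :: nat poly).
    \<forall>(A :: auction) (p :: real) (bhat :: strategy).
      auction_ok A \<longrightarrow>
      0 < p \<longrightarrow> p \<le> 1 \<longrightarrow>
      (\<exists>b\<in>real_strategies A. \<forall>i\<in>{1..nc A}. exp_revenue A b i - exp_payment mech A b i \<ge> tgt A i) \<longrightarrow>
      is_arg_max (surplus mech A) (\<lambda>b. b \<in> disc_strategies A p) bhat \<longrightarrow>
      (\<exists>T final \<gamma> q.
        exec (nc A) (strategies A p) (exp_revenue A) (exp_payment mech A)
          prog (init_state A p bhat) T final \<and>
        T \<le> poly time_bound (nc A + ne A + slots A + bits A) \<and>
        outputs (nc A) final \<gamma> q \<and>
        set_pmf \<gamma> \<subseteq> strategies A p \<and>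
        approx_IC p A (measure_pmf \<gamma>) q \<and>
        IR mech A (measure_pmf \<gamma>) q \<and>
        agency_value mech A (measure_pmf \<gamma>) \<ge> OPT mech A - p * real (nc A))"
\<comment> \<open>The polynomial is \<open>4 + 11 * x\<close>, matching the exact running time
  \<open>11 * nc A + 4\<close>.\<close>
proof (rule exI[of _ transfer_program], rule exI[of _ "[:4, 11:]"], intro allI impI)
  fix A :: auction and p :: real and bhat :: strategy
  assume ok: "auction_ok A" and p: "0 < p" "p \<le> 1"
    and "\<exists>b\<in>real_strategies A. \<forall>i\<in>{1..nc A}. exp_revenue A b i - exp_payment mech A b i \<ge> tgt A i"
    and "is_arg_max (surplus mech A) (\<lambda>b. b \<in> disc_strategies A p) bhat"
  then obtain b where b: "b \<in> real_strategies A"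
    and feasible: "\<And>i. i \<in> {1..nc A} \<Longrightarrow> tgt A i \<le> exp_revenue A b i - exp_payment mech A b i"
    and bhat: "bhat \<in> disc_strategies A p"
    and opt: "\<And>d. d \<in> disc_strategies A p \<Longrightarrow> surplus mech A d \<le> surplus mech A bhat"
    unfolding is_arg_max_def not_ex by (metis not_le)
  \<comment> \<open>This single estimate yields both IR and the bound on \<open>OPT\<close>.\<close>
  have near: "surplus mech A b \<le> surplus mech A bhat + p * real (nc A)"
    if b: "b \<in> real_strategies A" for b
  proof -
    from surplus_discretize[OF ok b, of p mech] p(1) obtain d
      where "d \<in> disc_strategies A p" "surplus mech A b - p * real (nc A) \<le> surplus mech A d"
      by auto
    with opt[of d] show ?thesis by linarith
  qed
  have S: "bhat \<in> strategies A p" "bhat \<in> extensional {1..nc A}"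
    using bhat unfolding strategies_def disc_strategies_def PiE_def by blast+
  let ?\<gamma> = "return_pmf bhat" and ?q = "\<lambda>i. exp_revenue A bhat i - tgt A i + p"
  obtain final where final:
    "exec (nc A) (strategies A p) (exp_revenue A) (exp_payment mech A) transfer_program
      (init_state A p bhat) (11 * nc A + 4) final" "progress A p bhat (nc A) final"
    using exec_transfer_program[OF S] by blast
  have agency: "agency_value mech A (measure_pmf ?\<gamma>) = surplus mech A bhat"
    by (simp add: agency_value_def surplus_def)
  \<comment> \<open>For the transfers \<open>?q\<close>, IR says precisely that the targets sum to
    at most \<open>surplus mech A bhat + p * real (nc A)\<close>. The feasible strategy has a
    surplus of at least this sum, and \<open>near\<close> carries it over to
    \<open>bhat\<close>.\<close>
  have "(\<Sum>i\<in>{1..nc A}. tgt A i) \<le> surplus mech A b"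
    unfolding surplus_def using feasible by (intro sum_mono)
  with near[OF b] have "(\<Sum>i\<in>{1..nc A}. tgt A i) \<le> surplus mech A bhat + p * real (nc A)"
    by linarith
  then have IR: "IR mech A (measure_pmf ?\<gamma>) ?q"
    unfolding IR_def surplus_def
    by (simp add: sum.distrib sum_subtractf mult.commute)
  show "\<exists>T final \<gamma> q.
        exec (nc A) (strategies A p) (exp_revenue A) (exp_payment mech A)
          transfer_program (init_state A p bhat) T final \<and>
        T \<le> poly [:4, 11:] (nc A + ne A + slots A + bits A) \<and>
        outputs (nc A) final \<gamma> q \<and>
        set_pmf \<gamma> \<subseteq> strategies A p \<and>
        approx_IC p A (measure_pmf \<gamma>) q \<and>
        IR mech A (measure_pmf \<gamma>) q \<and>
        agency_value mech A (measure_pmf \<gamma>) \<ge> OPT mech A - p * real (nc A)"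
  proof (intro exI conjI)
    show "exec (nc A) (strategies A p) (exp_revenue A) (exp_payment mech A) transfer_program
      (init_state A p bhat) (11 * nc A + 4) final" by (rule final(1))
    show "outputs (nc A) final ?\<gamma> ?q" by (rule outputs_progress[OF final(2) S(2)])
    show "11 * nc A + 4 \<le> poly [:4, 11:] (nc A + ne A + slots A + bits A)" by simp
    show "set_pmf ?\<gamma> \<subseteq> strategies A p" using S(1) by simp
    show "approx_IC p A (measure_pmf ?\<gamma>) ?q" by (simp add: approx_IC_def)
    show "IR mech A (measure_pmf ?\<gamma>) ?q" by (rule IR)
    show "OPT mech A - p * real (nc A) \<le> agency_value mech A (measure_pmf ?\<gamma>)"
      using OPT_le[OF ok b feasible near] unfolding agency by linarith
  qed
qed

end
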